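(* Let $n\ge 3$ be an integer. There exists a finite simplicial complex $\widetilde{J}_n$ of dimension $n+1$ such that: (1) $\dim \mathrm{H}_n(\widetilde{J}_n)=1$; (2) for the filtration $\mathcal{F}$ given by $\emptyset=K_0\subset K_1=\widetilde{J}_n$, there exist a generic bar $b=(1,\infty;1)\in\mathbf{B}_n(\mathcal{F})$ with a harmonic representative $h$, and simplices $\sigma\in\Sigma(b)$, $\tau\in\widetilde{J}_n^{[n]}\setminus\Sigma(b)$, such that $|\langle h,\sigma\rangle|<|\langle h,\tau\rangle|$.
   Context: **Chains.** A finite simplicial complex $K$ is a (possibly empty) set of subsets of a finite set $\{0,\dots,m\}$, closed under passing to subsets. $K^{[p]}$ is the set of $p$-dimensional simplices $[i_0,\dots,i_p]$, $i_0<\cdots<i_p$. $C_p(K)$ is the real vector space with basis $K^{[p]}$, with $\partial_p[i_0,\dots,i_p]=\sum_j(-1)^j[i_0,\dots,\widehat{i_j},\dots,i_p]$ (and $\partial_0=0$). $Z_p(K)=\ker\partial_p$, $B_p(K)=\operatorname{Im}\partial_{p+1}$, $\mathrm{H}_p(K)=Z_p(K)/B_p(K)$ (real, unreduced), and $\phi_p(K):Z_p(K)\to \mathrm{H}_p(K)$ is the quotient map. $C_p(K)$ carries the inner product $\langle\cdot,\cdot\rangle$ for which $K^{[p]}$ is orthonormal; for a subcomplex $L\subset K$ we regard $C_p(L)\subset C_p(K)$. The harmonic homology subspace is $\mathcal{H}_p(K)=Z_p(K)\cap B_p(K)^\perp$. The support of $z=\sum c_\sigma\sigma$ is $\operatorname{supp}(z)=\{\sigma: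 c_\sigma\ne0\}$. **Persistence.** Let $T=\{0,\dots,N\}$ and let $\mathcal{F}=(K_t)_{t\in T}$ be a filtration $K_0\subset\cdots\subset K_N=K$; set $K_{-1}=\emptyset$. For $s\le t$, $i_p^{s,t}:\mathrm{H}_p(K_s)\to \mathrm{H}_p(K_t)$ is induced by inclusion and $\mathrm{H}_p^{s,t}(\mathcal{F})=\operatorname{Im}(i_p^{s,t})$. For $s\le t$ in $T$ let $M_p^{s,t}(\mathcal{F})=(i_p^{s,t})^{-1}(\mathrm{H}_p^{s-1,t}(\mathcal{F}))\subset \mathrm{H}_p(K_s)$. For $s<t$ in $T$ let $P_p^{s,t}(\mathcal{F})=M_p^{s,t}(\mathcal{F})/M_p^{s,t-1}(\mathcal{F})$, and let $P_p^{s,\infty}(\mathcal{F})=\mathrm{H}_p(K_s)/M_p^{s,N}(\mathcal{F})$. Put $\mu_p^{s,t}(\mathcal{F})=\dim P_p^{s,t}(\mathcal{F})$ for $s\in T$, $t\in T\cup\{\infty\}$, $s<t$. The barcode is $\mathbf{B}_p(\mathcal{F})=\{(s,t;\mu_p^{s,t}(\mathcal{F})):\mu_p^{s,t}(\mathcal{F})>0\}$; its elements are called bars. A bar is simple if $\mu_p^{s,t}(\mathcal{F})=1$. It is generic if it is simple and $\mu_p^{s,t'}(\mathcal{F})=0$ for every $t'\in T\cup\{\infty\}$ with $t'>s$, $t'\ne t$. **Harmonic representatives.** For $s\le t$, let $\mathfrak{i}_p^{s,t}:\mathcal{H}_p(K_s)\to\mathcal{H}_p(K_t)$ be the restriction to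 $\mathcal{H}_p(K_s)$ of orthogonal projection onto $B_p(K_t)^\perp$, and $\mathcal{H}_p^{s,t}(\mathcal{F})=\operatorname{Im}\mathfrak{i}_p^{s,t}$. Let $\mathcal{M}_p^{s,t}(\mathcal{F})=(\mathfrak{i}_p^{s,t})^{-1}(\mathcal{H}_p^{s-1,t}(\mathcal{F}))$ for $s\le t$, $\mathcal{P}_p^{s,t}(\mathcal{F})=\mathcal{M}_p^{s,t}(\mathcal{F})\cap\mathcal{M}_p^{s,t-1}(\mathcal{F})^\perp$ for $s<t\le N$, and $\mathcal{P}_p^{s,\infty}(\mathcal{F})=\mathcal{H}_p(K_s)\cap\mathcal{M}_p^{s,N}(\mathcal{F})^\perp$. A harmonic representative of a simple bar $b=(s,t;1)$ is any nonzero element of $\mathcal{P}_p^{s,t}(\mathcal{F})$. **Essential simplices.** Let $\widetilde{M}_p^{s,t}(\mathcal{F})=\phi_p(K_s)^{-1}(M_p^{s,t}(\mathcal{F}))\subset Z_p(K_s)$. For a simple bar $b=(s,t;1)$, $\mathrm{Rep}(b)=\widetilde{M}_p^{s,t}(\mathcal{F})\setminus\widetilde{M}_p^{s,t-1}(\mathcal{F})$ if $t\neq\infty$, and $\mathrm{Rep}(b)=Z_p(K_s)\setminus\widetilde{M}_p^{s,N}(\mathcal{F})$ if $t=\infty$. The set of essential simplices of $b$ is $\Sigma(b)=\bigcap_{z\in\mathrm{Rep}(b)}\operatorname{supp}(z)$. *)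

theory Defs
  imports "Jordan_Normal_Form.VS_Connect" "HOL-Algebra.AbelCoset" "HOL-Library.Extended_Nat"
begin

section \<open>Quotients of vector spaces\<close>

text \<open>Vector spaces are the carrier-based records of the session VectorSpace; the field of real
  numbers is \<^term>\<open>class_ring :: real ring\<close>. The fields \<open>mult\<close> and \<open>one\<close> of a module record play
  no role.\<close>

definition quot_space :: "('a, 'b) module \<Rightarrow> 'b set \<Rightarrow> ('a, 'b set) module" where
  "quot_space V W = \<lparr>carrier = a_rcosets\<^bsub>V\<^esub> W, mult = undefined, one = undefined,
     zero = W, add = set_add V, smult = (\<lambda>r X. \<Union>x\<in>X. W +>\<^bsub>V\<^esub> (r \<odot>\<^bsub>V\<^esub> x))\<rparr>"

text \<open>For a subspace \<open>W\<close> the quotient is indeed a vector space, with well-defined scalar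
  multiplication.\<close>

lemma subspace_imp_abelian_subgroup:
  assumes "vectorspace K V" "VectorSpace.subspace K W V"
  shows "abelian_subgroup W V"
proof -
  interpret V: vectorspace K V by fact
  interpret W: submodule K W V using assms(2) by (simp add: VectorSpace.subspace_def)
  have "subgroup W (add_monoid V)"
  proof (rule V.add.subgroupI)
    show "W \<subseteq> carrier V" by (rule W.subset)
    show "W \<noteq> {}" using W.zero_closed by blast
    fix a b assume a: "a \<in> W" "b \<in> W"
    have "a \<in> carrier V" using a W.subset by blast
    moreover have "\<ominus>\<^bsub>K\<^esub> \<one>\<^bsub>K\<^esub> \<odot>\<^bsub>V\<^esub> a \<in> W" using a by (intro W.smult_closed) simp_all
    ultimately show "\<ominus>\<^bsub>V\<^esub> a \<in> W" using V.smult_minus_1[of a] by (metis)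
    show "a \<oplus>\<^bsub>V\<^esub> b \<in> W" using a by simp
  qed
  then show ?thesis
    by (intro abelian_subgroupI3 additive_subgroup.intro V.abelian_group_axioms)
qed

lemma coset_smult:
  assumes "vectorspace K V" "VectorSpace.subspace K W V" "r \<in> carrier K" "x \<in> carrier V"
  shows "(\<Union>y\<in>W +>\<^bsub>V\<^esub> x. W +>\<^bsub>V\<^esub> (r \<odot>\<^bsub>V\<^esub> y)) = W +>\<^bsub>V\<^esub> (r \<odot>\<^bsub>V\<^esub> x)"
proof -
  interpret V: vectorspace K V by fact
  interpret W: submodule K W V using assms(2) by (simp add: VectorSpace.subspace_def)
  interpret S: abelian_subgroup W V by (rule subspace_imp_abelian_subgroup[OF assms(1,2)])
  have "W +>\<^bsub>V\<^esub> (r \<odot>\<^bsub>V\<^esub> y) = W +>\<^bsub>V\<^esub> (r \<odot>\<^bsub>V\<^esub> x)" if y: "y \<in> W +>\<^bsub>V\<^esub> x" for y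
  proof -
    obtain w where w: "w \<in> W" "y = w \<oplus>\<^bsub>V\<^esub> x" using y by (auto simp: a_r_coset_def')
    have "r \<odot>\<^bsub>V\<^esub> y = r \<odot>\<^bsub>V\<^esub> w \<oplus>\<^bsub>V\<^esub> r \<odot>\<^bsub>V\<^esub> x"
      using w assms W.subset by (auto simp: V.smult_r_distr)
    then have "r \<odot>\<^bsub>V\<^esub> y \<in> W +>\<^bsub>V\<^esub> (r \<odot>\<^bsub>V\<^esub> x)"
      using w assms by (auto simp: a_r_coset_def')
    then show ?thesis using assms by (metis S.a_repr_independence' V.smult_closed)
  qed
  moreover have "x \<in> W +>\<^bsub>V\<^esub> x" using assms by (simp add: S.a_rcos_self)
  ultimately show ?thesis by blast
qed

lemma vectorspace_quot_space:
  assumes "vectorspace K V" "VectorSpace.subspace K W V"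
  shows "vectorspace K (quot_space V W)"
proof -
  interpret V: vectorspace K V by fact
  interpret W: submodule K W V using assms(2) by (simp add: VectorSpace.subspace_def)
  interpret S: abelian_subgroup W V by (rule subspace_imp_abelian_subgroup[OF assms(1,2)])
  have z: "W = W +>\<^bsub>V\<^esub> \<zero>\<^bsub>V\<^esub>" using W.subset by (metis V.a_coset_add_zero)
  have car: "carrier (quot_space V W) = (\<lambda>x. W +>\<^bsub>V\<^esub> x) ` carrier V"
    by (auto simp: quot_space_def A_RCOSETS_def')
  have add: "(W +>\<^bsub>V\<^esub> x) \<oplus>\<^bsub>quot_space V W\<^esub> (W +>\<^bsub>V\<^esub> y) = W +>\<^bsub>V\<^esub> (x \<oplus>\<^bsub>V\<^esub> y)"
    if "x \<in> carrier V" "y \<in> carrier V" for x y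
    using that by (simp add: quot_space_def S.a_rcos_sum)
  have sm: "r \<odot>\<^bsub>quot_space V W\<^esub> (W +>\<^bsub>V\<^esub> x) = W +>\<^bsub>V\<^esub> (r \<odot>\<^bsub>V\<^esub> x)"
    if "r \<in> carrier K" "x \<in> carrier V" for r x
    using coset_smult[OF assms that] by (simp add: quot_space_def)
  have zero: "\<zero>\<^bsub>quot_space V W\<^esub> = W +>\<^bsub>V\<^esub> \<zero>\<^bsub>V\<^esub>" using z by (simp add: quot_space_def)
  show ?thesis
  proof (rule vs_criteria)
    show "field K" by (rule V.field_axioms)
    show "\<forall>v\<in>carrier (quot_space V W). \<exists>w\<in>carrier (quot_space V W). v \<oplus>\<^bsub>quot_space V W\<^esub> w = \<zero>\<^bsub>quot_space V W\<^esub>"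
      unfolding car zero by (auto simp: add V.r_neg intro!: bexI[where x="\<ominus>\<^bsub>V\<^esub> _"])
    show "\<forall>v w. v \<in> carrier (quot_space V W) \<and> w \<in> carrier (quot_space V W) \<longrightarrow>
        v \<oplus>\<^bsub>quot_space V W\<^esub> w = w \<oplus>\<^bsub>quot_space V W\<^esub> v"
      unfolding car by (clarsimp simp: add) (metis V.a_comm)
  qed (auto simp: car add zero sm V.a_assoc V.smult_l_distr V.smult_r_distr V.smult_assoc1)
qed

abbreviation real_dim :: "(real, 'b) module \<Rightarrow> nat" where
  "real_dim V \<equiv> vectorspace.dim class_ring V"


section \<open>Simplicial complexes and chains\<close>

type_synonym scomplex = "nat set set"

definition finite_complex :: "scomplex \<Rightarrow> bool" where
  "finite_complex K \<longleftrightarrow> (\<exists>m. K \<subseteq> Pow {0..m}) \<and> (\<forall>\<sigma>\<in>K. \<forall>\<tau>. \<tau> \<subseteq> \<sigma> \<longrightarrow> \<tau> \<in> K)"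

definition simplices :: "nat \<Rightarrow> scomplex \<Rightarrow> nat set set" where
  "simplices p K = {\<sigma> \<in> K. card \<sigma> = p + 1}"

definition complex_dim :: "scomplex \<Rightarrow> int" where
  "complex_dim K = (if K = {} then -1 else (MAX \<sigma>\<in>K. int (card \<sigma>) - 1))"

text \<open>A chain is its coefficient function, so that the chains of a subcomplex are literally chains
  of the larger complex.\<close>

type_synonym chain = "nat set \<Rightarrow> real"

definition single :: "nat set \<Rightarrow> chain" where
  "single \<sigma> = (\<lambda>\<tau>. if \<tau> = \<sigma> then 1 else 0)"

definition supp :: "chain \<Rightarrow> nat set set" where
  "supp z = {\<sigma>. z \<sigma> \<noteq> 0}"

definition chain_space :: "nat \<Rightarrow> scomplex \<Rightarrow> (real, chain) module" where
  "chain_space p K = \<lparr>carrier = {c. supp c \<subseteq> simplices p K}, mult = undefined, one = undefined,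
     zero = (\<lambda>\<sigma>. 0), add = (\<lambda>c d \<sigma>. c \<sigma> + d \<sigma>), smult = (\<lambda>r c \<sigma>. r * c \<sigma>)\<rparr>"

definition boundary_simplex :: "nat \<Rightarrow> nat set \<Rightarrow> chain" where
  "boundary_simplex p \<sigma> =
     (if p = 0 then (\<lambda>\<tau>. 0)
      else (\<lambda>\<tau>. \<Sum>j=0..p. (-1) ^ j * single (\<sigma> - {sorted_list_of_set \<sigma> ! j}) \<tau>))"

definition boundary :: "nat \<Rightarrow> scomplex \<Rightarrow> chain \<Rightarrow> chain" where
  "boundary p K c = (\<lambda>\<tau>. \<Sum>\<sigma>\<in>simplices p K. c \<sigma> * boundary_simplex p \<sigma> \<tau>)"

definition cycles :: "nat \<Rightarrow> scomplex \<Rightarrow> chain set" where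
  "cycles p K = {c \<in> carrier (chain_space p K). boundary p K c = (\<lambda>\<tau>. 0)}"

definition boundaries :: "nat \<Rightarrow> scomplex \<Rightarrow> chain set" where
  "boundaries p K = boundary (p + 1) K ` carrier (chain_space (p + 1) K)"

definition homology :: "nat \<Rightarrow> scomplex \<Rightarrow> (real, chain set) module" where
  "homology p K = quot_space ((chain_space p K)\<lparr>carrier := cycles p K\<rparr>) (boundaries p K)"

definition hom_class :: "nat \<Rightarrow> scomplex \<Rightarrow> chain \<Rightarrow> chain set" where
  "hom_class p K z = boundaries p K +>\<^bsub>chain_space p K\<^esub> z"

definition chain_inner :: "nat \<Rightarrow> scomplex \<Rightarrow> chain \<Rightarrow> chain \<Rightarrow> real" where
  "chain_inner p K c d = (\<Sum>\<sigma>\<in>simplices p K. c \<sigma> * d \<sigma>)"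

definition orth :: "nat \<Rightarrow> scomplex \<Rightarrow> chain set \<Rightarrow> chain set" where
  "orth p K U = {c \<in> carrier (chain_space p K). \<forall>u\<in>U. chain_inner p K c u = 0}"

definition orth_proj :: "nat \<Rightarrow> scomplex \<Rightarrow> chain set \<Rightarrow> chain \<Rightarrow> chain" where
  "orth_proj p K U c = (THE u. u \<in> U \<and> (\<lambda>\<sigma>. c \<sigma> - u \<sigma>) \<in> orth p K U)"

definition harmonic :: "nat \<Rightarrow> scomplex \<Rightarrow> chain set" where
  "harmonic p K = cycles p K \<inter> orth p K (boundaries p K)"


section \<open>Filtrations and barcodes\<close>

text \<open>The list \<open>F = [K\<^sub>0, \<dots>, K\<^sub>N]\<close> is the filtration, so \<open>N = length F - 1\<close>;
  \<open>prev F s\<close> is \<open>K\<^sub>s\<^sub>-\<^sub>1\<close>, with \<open>K\<^sub>-\<^sub>1\<close> empty.\<close>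

type_synonym filtration = "scomplex list"

definition is_filtration :: "filtration \<Rightarrow> bool" where
  "is_filtration F \<longleftrightarrow> F \<noteq> [] \<and> (\<forall>K\<in>set F. finite_complex K) \<and>
     (\<forall>t. Suc t < length F \<longrightarrow> F ! t \<subseteq> F ! Suc t)"

definition last_time :: "filtration \<Rightarrow> nat" where
  "last_time F = length F - 1"

definition prev :: "filtration \<Rightarrow> nat \<Rightarrow> scomplex" where
  "prev F s = (if s = 0 then {} else F ! (s - 1))"

definition ext_times :: "filtration \<Rightarrow> enat set" where
  "ext_times F = insert \<infinity> (enat ` {0..last_time F})"

text \<open>For a subcomplex \<open>L\<close> of \<open>K\<close>, all representatives of a class of \<open>L\<close> have the same class
  in \<open>K\<close>.\<close>

definition hom_induced :: "nat \<Rightarrow> scomplex \<Rightarrow> scomplex \<Rightarrow> chain set \<Rightarrow> chain set" where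
  "hom_induced p L K x = the_elem (hom_class p K ` x)"

definition hom_image :: "nat \<Rightarrow> scomplex \<Rightarrow> scomplex \<Rightarrow> chain set set" where
  "hom_image p L K = hom_induced p L K ` carrier (homology p L)"

definition M_space :: "nat \<Rightarrow> filtration \<Rightarrow> nat \<Rightarrow> nat \<Rightarrow> chain set set" where
  "M_space p F s t =
     {x \<in> carrier (homology p (F ! s)). hom_induced p (F ! s) (F ! t) x \<in> hom_image p (prev F s) (F ! t)}"

definition P_space :: "nat \<Rightarrow> filtration \<Rightarrow> nat \<Rightarrow> enat \<Rightarrow> (real, chain set set) module" where
  "P_space p F s t = (case t of
       enat t' \<Rightarrow> quot_space ((homology p (F ! s))\<lparr>carrier := M_space p F s t'\<rparr>) (M_space p F s (t' - 1))
     | \<infinity> \<Rightarrow> quot_space (homology p (F ! s)) (M_space p F s (last_time F)))"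

definition multiplicity :: "nat \<Rightarrow> filtration \<Rightarrow> nat \<Rightarrow> enat \<Rightarrow> nat" where
  "multiplicity p F s t = real_dim (P_space p F s t)"

type_synonym bar = "nat \<times> enat \<times> nat"

definition barcode :: "nat \<Rightarrow> filtration \<Rightarrow> bar set" where
  "barcode p F = {(s, t, multiplicity p F s t) | s t.
     s \<le> last_time F \<and> t \<in> ext_times F \<and> enat s < t \<and> multiplicity p F s t > 0}"

definition simple_bar :: "nat \<Rightarrow> filtration \<Rightarrow> bar \<Rightarrow> bool" where
  "simple_bar p F = (\<lambda>(s, t, m). (s, t, m) \<in> barcode p F \<and> multiplicity p F s t = 1)"

definition generic_bar :: "nat \<Rightarrow> filtration \<Rightarrow> bar \<Rightarrow> bool" where
  "generic_bar p F = (\<lambda>(s, t, m). simple_bar p F (s, t, m) \<and>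
     (\<forall>t'\<in>ext_times F. enat s < t' \<and> t' \<noteq> t \<longrightarrow> multiplicity p F s t' = 0))"


section \<open>Harmonic representatives\<close>

definition harm_map :: "nat \<Rightarrow> scomplex \<Rightarrow> chain \<Rightarrow> chain" where
  "harm_map p K = orth_proj p K (orth p K (boundaries p K))"

definition harm_M :: "nat \<Rightarrow> filtration \<Rightarrow> nat \<Rightarrow> nat \<Rightarrow> chain set" where
  "harm_M p F s t =
     {z \<in> harmonic p (F ! s). harm_map p (F ! t) z \<in> harm_map p (F ! t) ` harmonic p (prev F s)}"

definition harm_P :: "nat \<Rightarrow> filtration \<Rightarrow> nat \<Rightarrow> enat \<Rightarrow> chain set" where
  "harm_P p F s t = (case t of
       enat t' \<Rightarrow> harm_M p F s t' \<inter> orth p (F ! s) (harm_M p F s (t' - 1))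
     | \<infinity> \<Rightarrow> harmonic p (F ! s) \<inter> orth p (F ! s) (harm_M p F s (last_time F)))"

definition harmonic_representative :: "nat \<Rightarrow> filtration \<Rightarrow> bar \<Rightarrow> chain \<Rightarrow> bool" where
  "harmonic_representative p F = (\<lambda>(s, t, m) h. simple_bar p F (s, t, m) \<and>
     h \<in> harm_P p F s t \<and> h \<noteq> (\<lambda>\<sigma>. 0))"


section \<open>Essential simplices\<close>

definition M_cycles :: "nat \<Rightarrow> filtration \<Rightarrow> nat \<Rightarrow> nat \<Rightarrow> chain set" where
  "M_cycles p F s t = {z \<in> cycles p (F ! s). hom_class p (F ! s) z \<in> M_space p F s t}"

definition Rep :: "nat \<Rightarrow> filtration \<Rightarrow> bar \<Rightarrow> chain set" where
  "Rep p F = (\<lambda>(s, t, m). case t of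
       enat t' \<Rightarrow> M_cycles p F s t' - M_cycles p F s (t' - 1)
     | \<infinity> \<Rightarrow> cycles p (F ! s) - M_cycles p F s (last_time F))"

text \<open>Only meaningful for simple bars, whose set of representatives is nonempty.\<close>

definition essential :: "nat \<Rightarrow> filtration \<Rightarrow> bar \<Rightarrow> nat set set" where
  "essential p F b = (\<Inter>z\<in>Rep p F b. supp z)"

end

theory Submission
  imports Defs
begin

text \<open>An \<open>n\<close>-simplex is essential for the bar \<open>(1, \<infinity>; 1)\<close> as soon as it occurs in a generating cycle
  \<open>z\<close> but in no \<open>(n + 1)\<close>-simplex. Choose \<open>z\<close> spanning the cycles on its own support, with coefficients
  \<open>\<plusminus>1\<close> at some \<open>\<sigma>\<close> and \<open>\<plusminus>2\<close> at some \<open>\<tau>\<close>: for \<open>n = 2\<close>, fill a noncontractible loop of the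
  projective plane by a triangle \<open>\<tau>\<close>; in higher dimensions, suspend. Coning off \<open>\<tau>\<close> with a new vertex
  yields a single \<open>(n + 1)\<close>-simplex, which makes \<open>\<tau>\<close> inessential and keeps \<open>\<sigma>\<close> essential. Projecting
  \<open>z\<close> orthogonally to the boundary of that simplex gives a harmonic representative whose coefficient at
  \<open>\<sigma>\<close> is still \<open>\<plusminus>1\<close>, while the one at \<open>\<tau>\<close> is only scaled by \<open>(n + 1) / (n + 2) > 1 / 2\<close>.\<close>

section \<open>The boundary map in terms of incidence signs\<close>

text \<open>For \<open>v\<close> outside \<open>\<rho>\<close> the exponent is the position of
  \<open>v\<close> in the sorted vertex list of \<open>insert v \<rho>\<close>, so this is the
  incidence sign of the face \<open>\<rho>\<close> in that simplex.\<close>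

definition inc_sign :: "nat set \<Rightarrow> nat \<Rightarrow> real" where
  "inc_sign \<rho> v = (-1) ^ card {u \<in> \<rho>. u < v}"

text \<open>On chains of a complex with vertices below \<open>m\<close>, this is the boundary map in every positive
  degree; it mentions neither the degree nor the complex.\<close>

definition bd :: "nat \<Rightarrow> chain \<Rightarrow> chain" where
  "bd m c = (\<lambda>\<rho>. \<Sum>v\<in>{..<m} - \<rho>. inc_sign \<rho> v * c (insert v \<rho>))"

lemma inc_sign_abs [simp]: "\<bar>inc_sign \<rho> v\<bar> = 1"
  by (simp add: inc_sign_def power_abs)

lemma inc_sign_nonzero [simp]: "inc_sign \<rho> v \<noteq> 0"
  by (simp add: inc_sign_def)

lemma bd_add_smult: "bd m (\<lambda>\<rho>. c \<rho> + r * d \<rho>) = (\<lambda>\<rho>. bd m c \<rho> + r * bd m d \<rho>)"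
  by (simp add: bd_def fun_eq_iff algebra_simps sum.distrib sum_distrib_left)

lemma bd_zero [simp]: "bd m (\<lambda>\<rho>. 0) = (\<lambda>\<rho>. 0)"
  by (simp add: bd_def)

lemma inc_sign_insert:
  assumes "finite \<rho>" "v \<notin> \<rho>"
  shows "inc_sign (insert v \<rho>) u = (if v < u then - inc_sign \<rho> u else inc_sign \<rho> u)"
proof -
  have "{x \<in> insert v \<rho>. x < u} = (if v < u then insert v {x \<in> \<rho>. x < u} else {x \<in> \<rho>. x < u})"
    by auto
  then show ?thesis using assms by (simp add: inc_sign_def)
qed

text \<open>Adding two vertices in either order gives opposite products of signs, so the double sum
  over ordered pairs equals its own negative.\<close>

lemma bd_bd:
  assumes "\<And>\<sigma>. c \<sigma> \<noteq> 0 \<Longrightarrow> finite \<sigma>"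
  shows "bd m (bd m c) = (\<lambda>\<rho>. 0)"
proof
  fix \<rho>
  show "bd m (bd m c) \<rho> = 0"
  proof (cases "finite \<rho>")
    case False
    then have "c (insert u (insert v \<rho>)) = 0" for u v using assms by (metis finite_insert)
    then show ?thesis by (simp add: bd_def)
  next
    case True
    let ?A = "{..<m} - \<rho>"
    \<comment> \<open>Setting the diagonal to zero lets both sums range over the same set
      \<open>?A\<close>, so that they can be exchanged.\<close>
    let ?f = "\<lambda>v u. if u = v then 0 else inc_sign \<rho> v * (inc_sign (insert v \<rho>) u * c (insert u (insert v \<rho>)))"
    have e: "bd m (bd m c) \<rho> = (\<Sum>v\<in>?A. \<Sum>u\<in>?A. ?f v u)"
      unfolding bd_def sum_distrib_left
      by (intro sum.cong refl sum.mono_neutral_cong_left) auto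
    have "?f v u = - ?f u v" if "v \<in> ?A" "u \<in> ?A" for u v
      using that True by (auto simp: inc_sign_insert insert_commute)
    then have "(\<Sum>v\<in>?A. \<Sum>u\<in>?A. ?f v u) = (\<Sum>v\<in>?A. \<Sum>u\<in>?A. - ?f u v)"
      by (intro sum.cong refl) blast
    also have "\<dots> = - (\<Sum>u\<in>?A. \<Sum>v\<in>?A. ?f u v)"
      by (subst sum.swap) (simp add: sum_negf)
    finally show ?thesis using e by linarith
  qed
qed

text \<open>The vertex at position \<open>j\<close> of the sorted list has exactly \<open>j\<close>
  smaller vertices, so \<open>(-1) ^ j\<close> is an incidence sign. In degree 0 the right-hand side
  would be the augmentation, whereas the boundary is zero by convention.\<close>

lemma boundary_simplex_eq:
  assumes "finite \<sigma>" "card \<sigma> = p + 1" "p > 0"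
  shows "boundary_simplex p \<sigma> \<rho> = (\<Sum>v\<in>\<sigma>. if \<rho> = \<sigma> - {v} then inc_sign \<rho> v else 0)"
proof -
  let ?l = "sorted_list_of_set \<sigma>"
  have len: "length ?l = p + 1" using assms by simp
  have bij: "bij_betw ((!) ?l) {..<length ?l} \<sigma>"
    using bij_betw_nth[of ?l "{..<length ?l}" \<sigma>] assms by simp
  have card: "card {u \<in> \<sigma>. u < ?l ! j} = j" if "j < length ?l" for j
  proof -
    have "{u \<in> \<sigma>. u < ?l ! j} = (!) ?l ` {..<j}"
    proof (intro equalityI subsetI)
      fix u assume "u \<in> {u \<in> \<sigma>. u < ?l ! j}"
      then have u: "u \<in> set ?l" "u < ?l ! j" using assms by auto
      then obtain i where i: "i < length ?l" "u = ?l ! i" by (metis in_set_conv_nth)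
      have "i < j" using u i that sorted_sorted_list_of_set[of \<sigma>]
        by (metis leD not_le_imp_less sorted_nth_mono)
      then show "u \<in> (!) ?l ` {..<j}" using i by auto
    next
      fix u assume "u \<in> (!) ?l ` {..<j}"
      then obtain i where i: "i < j" "u = ?l ! i" by auto
      then have "?l ! i < ?l ! j"
        using strict_sorted_list_of_set[of \<sigma>] that by (simp add: sorted_wrt_iff_nth_less)
      moreover have "u \<in> set ?l" using i that by auto
      ultimately show "u \<in> {u \<in> \<sigma>. u < ?l ! j}" using i assms by simp
    qed
    moreover have "inj_on ((!) ?l) {..<j}"
      using bij that by (auto simp: bij_betw_def intro: inj_on_subset)
    ultimately show ?thesis by (simp add: card_image)
  qed
  have "boundary_simplex p \<sigma> \<rho> = (\<Sum>j<length ?l. (-1) ^ j * single (\<sigma> - {?l ! j}) \<rho>)"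
    using assms len by (simp add: boundary_simplex_def atLeast0AtMost lessThan_Suc_atMost del: length_sorted_list_of_set)
  also have "\<dots> = (\<Sum>j<length ?l. if \<rho> = \<sigma> - {?l ! j} then inc_sign \<rho> (?l ! j) else 0)"
  proof (intro sum.cong refl)
    fix j assume "j \<in> {..<length ?l}"
    then have "card {u \<in> \<sigma> - {?l ! j}. u < ?l ! j} = j"
      using card[of j] by (metis (mono_tags, lifting) Collect_cong DiffD1 DiffI lessThan_iff order_less_irrefl singletonD)
    then show "(-1) ^ j * single (\<sigma> - {?l ! j}) \<rho> = (if \<rho> = \<sigma> - {?l ! j} then inc_sign \<rho> (?l ! j) else 0)"
      by (auto simp: single_def inc_sign_def)
  qed
  also have "\<dots> = (\<Sum>v\<in>\<sigma>. if \<rho> = \<sigma> - {v} then inc_sign \<rho> v else 0)"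
    by (rule sum.reindex_bij_betw[OF bij])
  finally show ?thesis .
qed

text \<open>Double counting of the pairs of a simplex and one of its vertices: one side sums over
  simplices first, the other over the vertices that extend \<open>\<rho>\<close>.\<close>

lemma boundary_eq_bd:
  assumes K: "K \<subseteq> Pow {..<m}" and p: "p > 0" and c: "c \<in> carrier (chain_space p K)"
  shows "boundary p K c = bd m c"
proof
  fix \<rho>
  have fin: "finite (simplices p K)"
    using K by (auto simp: simplices_def intro: finite_subset[OF _ finite_Pow_iff[THEN iffD2]])
  have s: "finite \<sigma>" "card \<sigma> = p + 1" "\<sigma> \<subseteq> {..<m}" if "\<sigma> \<in> simplices p K" for \<sigma>
    using that K by (auto simp: simplices_def intro: finite_subset)
  have c0: "c \<sigma> = 0" if "\<sigma> \<notin> simplices p K" for \<sigma>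
    using that c by (auto simp: chain_space_def supp_def)
  let ?S = "Sigma (simplices p K) (\<lambda>\<sigma>. \<sigma>)"
  let ?T = "{v. v < m \<and> v \<notin> \<rho> \<and> insert v \<rho> \<in> simplices p K}"
  have "boundary p K c \<rho> =
      (\<Sum>\<sigma>\<in>simplices p K. \<Sum>v\<in>\<sigma>. if \<rho> = \<sigma> - {v} then c \<sigma> * inc_sign \<rho> v else 0)"
    unfolding boundary_def
    by (intro sum.cong refl) (simp add: boundary_simplex_eq s p sum_distrib_left if_distrib cong: if_cong)
  also have "\<dots> = (\<Sum>(\<sigma>, v)\<in>?S. if \<rho> = \<sigma> - {v} then c \<sigma> * inc_sign \<rho> v else 0)"
    using fin s by (intro sum.Sigma) auto
  \<comment> \<open>A pair contributes only if \<open>\<sigma>\<close> is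
    \<open>insert v \<rho>\<close> with \<open>v\<close> outside \<open>\<rho>\<close>, so
    \<open>v\<close> alone can serve as index.\<close>
  also have "\<dots> = (\<Sum>(\<sigma>, v)\<in>(\<lambda>v. (insert v \<rho>, v)) ` ?T. c \<sigma> * inc_sign \<rho> v)"
    using fin s by (intro sum.mono_neutral_cong_right finite_SigmaI) (auto simp: insert_absorb image_iff dest: subsetD[OF s(3)])
  also have "\<dots> = (\<Sum>v\<in>?T. c (insert v \<rho>) * inc_sign \<rho> v)"
    by (subst sum.reindex) (auto simp: inj_on_def)
  also have "\<dots> = bd m c \<rho>"
    unfolding bd_def by (intro sum.mono_neutral_cong_left) (auto intro: c0)
  finally show "boundary p K c \<rho> = bd m c \<rho>" .
qed

section \<open>Circuits and suspension\<close>

text \<open>Circuits are understood in the sense of simplicial matroids: the \<open>p\<close>-cycles supported on the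
  support of \<open>z\<close> form a line.\<close>

definition circuit :: "nat \<Rightarrow> nat \<Rightarrow> chain \<Rightarrow> bool" where
  "circuit p m z \<longleftrightarrow> supp z \<subseteq> {\<sigma>. \<sigma> \<subseteq> {..<m} \<and> card \<sigma> = p + 1} \<and> bd m z = (\<lambda>\<rho>. 0) \<and>
     (\<forall>c. supp c \<subseteq> supp z \<longrightarrow> bd m c = (\<lambda>\<rho>. 0) \<longrightarrow> (\<exists>r. c = (\<lambda>\<sigma>. r * z \<sigma>)))"

text \<open>The two suspension points \<open>m\<close> and \<open>Suc m\<close> lie above all vertices of \<open>z\<close>, so that joining them
  does not change the signs of incidences within the base.\<close>

definition suspension :: "nat \<Rightarrow> chain \<Rightarrow> chain" where
  "suspension m z \<sigma> =
     (if m \<in> \<sigma> then z (\<sigma> - {m}) else if Suc m \<in> \<sigma> then - z (\<sigma> - {Suc m}) else 0)"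

lemma bd_Suc: "bd (Suc m) c \<rho> = bd m c \<rho> + (if m \<in> \<rho> then 0 else inc_sign \<rho> m * c (insert m \<rho>))"
proof -
  have "{..<Suc m} - \<rho> = (if m \<in> \<rho> then {..<m} - \<rho> else insert m ({..<m} - \<rho>))"
    by (auto simp: less_Suc_eq)
  then show ?thesis by (simp add: bd_def)
qed

lemma inc_sign_remove:
  assumes "v \<le> w"
  shows "inc_sign (\<rho> - {w}) v = inc_sign \<rho> v"
proof -
  have "{u \<in> \<rho> - {w}. u < v} = {u \<in> \<rho>. u < v}" using assms by auto
  then show ?thesis by (simp only: inc_sign_def)
qed

lemma inc_sign_Suc:
  assumes "m \<notin> \<rho>"
  shows "inc_sign \<rho> (Suc m) = inc_sign \<rho> m"
proof -
  have "{u \<in> \<rho>. u < Suc m} = {u \<in> \<rho>. u < m}" using assms by (auto simp: less_Suc_eq)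
  then show ?thesis by (simp only: inc_sign_def)
qed

text \<open>At a face through exactly one suspension point, the boundary is up to sign that of
  \<open>z\<close> on the rest of the face. At a face in the base, the contributions of the two
  suspension points cancel. No simplex of the suspension contains both points.\<close>

lemma bd_suspension:
  assumes z: "\<And>\<sigma>. z \<sigma> \<noteq> 0 \<Longrightarrow> \<sigma> \<subseteq> {..<m}" and bd: "bd m z = (\<lambda>\<rho>. 0)"
  shows "bd (Suc (Suc m)) (suspension m z) = (\<lambda>\<rho>. 0)"
proof
  fix \<rho>
  have z0: "z \<sigma> = 0" if "m \<in> \<sigma> \<or> Suc m \<in> \<sigma>" for \<sigma> using z[of \<sigma>] that by (cases "z \<sigma> = 0") auto
  \<comment> \<open>A point \<open>w\<close> above all base vertices changes neither the signs nor
    the index set.\<close>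
  have link: "(\<Sum>v\<in>{..<m} - \<rho>. inc_sign \<rho> v * z (insert v \<rho> - {w})) = 0" if "m \<le> w" for w
  proof -
    have "(\<Sum>v\<in>{..<m} - \<rho>. inc_sign \<rho> v * z (insert v \<rho> - {w})) = bd m z (\<rho> - {w})"
      unfolding bd_def using that
      by (intro sum.cong) (auto simp: inc_sign_remove insert_Diff_if)
    then show ?thesis using bd by simp
  qed
  consider "m \<in> \<rho>" | "m \<notin> \<rho>" "Suc m \<in> \<rho>" | "m \<notin> \<rho>" "Suc m \<notin> \<rho>" by blast
  then show "bd (Suc (Suc m)) (suspension m z) \<rho> = 0"
  proof cases
    case 1
    then have "bd m (suspension m z) \<rho> = 0"
      using link[of m] by (simp add: bd_def suspension_def)
    then show ?thesis using 1 by (simp add: bd_Suc suspension_def z0)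
  next
    case 2
    then have "bd m (suspension m z) \<rho> = - (\<Sum>v\<in>{..<m} - \<rho>. inc_sign \<rho> v * z (insert v \<rho> - {Suc m}))"
      unfolding bd_def sum_negf[symmetric] by (intro sum.cong) (auto simp: suspension_def)
    then show ?thesis using 2 link[of "Suc m"] by (simp add: bd_Suc suspension_def z0)
  next
    case 3
    then have "bd m (suspension m z) \<rho> = 0"
      unfolding bd_def by (intro sum.neutral) (auto simp: suspension_def)
    then show ?thesis using 3 by (simp add: bd_Suc suspension_def inc_sign_Suc)
  qed
qed

text \<open>For a cycle \<open>c\<close> on the support of the suspension, the link of
  \<open>m\<close> in \<open>c\<close> is a cycle on the support of \<open>z\<close>, hence a
  multiple of \<open>z\<close>. The boundary condition at the base simplices then determines
  \<open>c\<close> at the other suspension point.\<close>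

lemma circuit_suspension:
  assumes "circuit p m z"
  shows "circuit (Suc p) (Suc (Suc m)) (suspension m z)"
proof -
  have z: "\<sigma> \<subseteq> {..<m}" "card \<sigma> = p + 1" if "z \<sigma> \<noteq> 0" for \<sigma>
    using assms that by (auto simp: circuit_def supp_def)
  have bd: "bd m z = (\<lambda>\<rho>. 0)" using assms by (simp add: circuit_def)
  have z0: "z \<sigma> = 0" if "m \<in> \<sigma> \<or> Suc m \<in> \<sigma>" for \<sigma> using z[of \<sigma>] that by (cases "z \<sigma> = 0") auto
  have 1: "\<sigma> \<subseteq> {..<Suc (Suc m)} \<and> card \<sigma> = Suc p + 1" if nz: "suspension m z \<sigma> \<noteq> 0" for \<sigma>
  proof -
    obtain w where w: "w \<in> {m, Suc m}" "w \<in> \<sigma>" "z (\<sigma> - {w}) \<noteq> 0"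
      using nz by (auto simp: suspension_def split: if_splits)
    note F = z[OF w(3)]
    have "finite (\<sigma> - {w})" using F(1) finite_subset by blast
    then have "card \<sigma> = Suc p + 1" using F(2) w(2) card_Suc_Diff1[of \<sigma> w] by simp
    moreover have "\<sigma> \<subseteq> {..<Suc (Suc m)}" using F(1) w(1) by (auto simp: less_Suc_eq)
    ultimately show ?thesis by blast
  qed
  have 2: "\<exists>r. c = (\<lambda>\<sigma>. r * suspension m z \<sigma>)"
    if sub: "supp c \<subseteq> supp (suspension m z)" and bdc: "bd (Suc (Suc m)) c = (\<lambda>\<rho>. 0)" for c
  proof -
    have c0: "c \<sigma> = 0" if "suspension m z \<sigma> = 0" for \<sigma> using sub that by (auto simp: supp_def)
    \<comment> \<open>The link of \<open>m\<close> in \<open>c\<close>. Restricting it to the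
      support of \<open>z\<close> loses nothing on sets avoiding \<open>m\<close> and makes the
      support condition of \<open>circuit\<close> immediate.\<close>
    define x where "x = (\<lambda>\<sigma>. if z \<sigma> \<noteq> 0 then c (insert m \<sigma>) else 0)"
    have x: "c (insert m \<sigma>) = x \<sigma>" if "m \<notin> \<sigma>" for \<sigma>
      using that by (auto simp: x_def suspension_def intro!: c0)
    have bdx: "bd m x \<rho> = 0" for \<rho>
    proof (cases "m \<in> \<rho> \<or> Suc m \<in> \<rho>")
      case True
      then show ?thesis unfolding bd_def by (intro sum.neutral) (auto simp: x_def z0)
    next
      case False
      have "inc_sign (insert m \<rho>) v = inc_sign \<rho> v" if "v < m" for v
        using inc_sign_remove[of v m "insert m \<rho>"] that False by simp
      \<comment> \<open>The boundary of the link at \<open>\<rho>\<close> is that of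
        \<open>c\<close> at \<open>insert m \<rho>\<close>. Adding \<open>Suc m\<close> contributes
        nothing, as no simplex of the suspension contains both points.\<close>
      then have "bd m x \<rho> = bd m c (insert m \<rho>)"
        unfolding bd_def using False
        by (intro sum.cong) (auto simp: x[symmetric] insert_commute)
      also have "\<dots> = bd (Suc (Suc m)) c (insert m \<rho>)"
        by (auto simp: bd_Suc suspension_def z0 intro!: c0)
      finally show ?thesis using bdc by simp
    qed
    have "supp x \<subseteq> supp z" by (auto simp: supp_def x_def)
    moreover have "bd m x = (\<lambda>\<rho>. 0)" using bdx by blast
    ultimately obtain r where r: "x = (\<lambda>\<sigma>. r * z \<sigma>)" using assms unfolding circuit_def by blast
    have m: "c (insert m \<sigma>) = r * z \<sigma>" if "m \<notin> \<sigma>" for \<sigma> using x[OF that] r by simp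
    have Sm: "c (insert (Suc m) \<sigma>) = - r * z \<sigma>" if "m \<notin> \<sigma>" "Suc m \<notin> \<sigma>" for \<sigma>
    proof -
      \<comment> \<open>Without a suspension point there is no simplex in the support, so only the
        cofaces through \<open>m\<close> and \<open>Suc m\<close> remain, and they carry the same
        sign.\<close>
      have "bd m c \<sigma> = 0"
        unfolding bd_def using that by (intro sum.neutral) (auto simp: suspension_def intro!: c0)
      then have "inc_sign \<sigma> m * (c (insert m \<sigma>) + c (insert (Suc m) \<sigma>)) = 0"
        using fun_cong[OF bdc, of \<sigma>] that by (simp add: bd_Suc inc_sign_Suc algebra_simps)
      then show ?thesis using m[OF that(1)] by simp
    qed
    have "c \<sigma> = r * suspension m z \<sigma>" for \<sigma>
    proof (cases "m \<in> \<sigma>")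
      case True
      then show ?thesis using m[of "\<sigma> - {m}"] by (simp add: suspension_def insert_absorb)
    next
      case False
      then show ?thesis using Sm[of "\<sigma> - {Suc m}"] c0[of \<sigma>]
        by (cases "Suc m \<in> \<sigma>") (auto simp: suspension_def insert_absorb)
    qed
    then show ?thesis by blast
  qed
  show ?thesis
    unfolding circuit_def
  proof (intro conjI allI impI)
    show "supp (suspension m z) \<subseteq> {\<sigma>. \<sigma> \<subseteq> {..<Suc (Suc m)} \<and> card \<sigma> = Suc p + 1}"
      using 1 by (auto simp: supp_def)
  qed (rule bd_suspension[OF z(1) bd], assumption, rule 2)
qed

section \<open>A circuit on the projective plane\<close>

text \<open>All triangles but \<open>{0,1,3}\<close> form the six-vertex triangulation of the projective plane. The loop
  \<open>0,1,3\<close> is noncontractible, and cutting along it yields a disc whose boundary runs twice around it;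
  hence the coefficient \<open>2\<close> of the additional triangle.\<close>

definition rp2_chain :: chain where
  "rp2_chain \<sigma> =
     (if \<sigma> = {0,1,3} then 2
      else if \<sigma> \<in> {{0,3,4}, {0,4,5}, {1,2,4}, {2,3,5}} then 1
      else if \<sigma> \<in> {{0,1,2}, {0,2,3}, {0,1,5}, {1,3,4}, {2,4,5}, {1,3,5}} then -1 else 0)"

lemma bd_edge:
  assumes "a < b"
  shows "bd m c {a, b} = (\<Sum>v\<in>{..<m} - {a, b}. if a < v \<and> v < b then - c {v, a, b} else c {v, a, b})"
proof -
  have "inc_sign {a, b} v = (if a < v \<and> v < b then -1 else 1)" if "v \<notin> {a, b}" for v
  proof -
    have "{u \<in> {a, b}. u < v} = (if b < v then {a, b} else if a < v then {a} else {})"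
      using assms by auto
    then show ?thesis using assms that by (auto simp: inc_sign_def)
  qed
  then show ?thesis unfolding bd_def by (intro sum.cong refl) simp
qed

lemma edge_cases:
  assumes "\<rho> \<subseteq> {..<6::nat}" "card \<rho> = 2"
  shows "\<rho> \<in> {{0,1},{0,2},{0,3},{0,4},{0,5},{1,2},{1,3},{1,4},{1,5},{2,3},{2,4},{2,5},{3,4},{3,5},{4,5}}"
proof -
  obtain a b where ab: "\<rho> = {a, b}" "a \<noteq> b" using assms(2) by (auto simp: card_2_iff)
  then have "a < 6" "b < 6" using assms by auto
  then have "a \<in> {0,1,2,3,4,5}" "b \<in> {0,1,2,3,4,5}" by auto
  then show ?thesis using ab by (elim insertE emptyE) (simp_all add: doubleton_eq_iff)
qed

lemma lessThan_6: "{..<6::nat} = {0,1,2,3,4,5}" by auto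

text \<open>The fifteen linear equations for a 2-cycle on six vertices. They serve both to check
  that \<open>rp2_chain\<close> is a cycle and to find all cycles on its support.\<close>

lemma bd_6_edges:
  "bd 6 c {0,1} = c {0,1,2} + c {0,1,3} + c {0,1,4} + c {0,1,5}"
  "bd 6 c {0,2} =  - c {0,1,2} + c {0,2,3} + c {0,2,4} + c {0,2,5}"
  "bd 6 c {0,3} =  - c {0,1,3} - c {0,2,3} + c {0,3,4} + c {0,3,5}"
  "bd 6 c {0,4} =  - c {0,1,4} - c {0,2,4} - c {0,3,4} + c {0,4,5}"
  "bd 6 c {0,5} =  - c {0,1,5} - c {0,2,5} - c {0,3,5} - c {0,4,5}"
  "bd 6 c {1,2} = c {0,1,2} + c {1,2,3} + c {1,2,4} + c {1,2,5}"
  "bd 6 c {1,3} = c {0,1,3} - c {1,2,3} + c {1,3,4} + c {1,3,5}"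
  "bd 6 c {1,4} = c {0,1,4} - c {1,2,4} - c {1,3,4} + c {1,4,5}"
  "bd 6 c {1,5} = c {0,1,5} - c {1,2,5} - c {1,3,5} - c {1,4,5}"
  "bd 6 c {2,3} = c {0,2,3} + c {1,2,3} + c {2,3,4} + c {2,3,5}"
  "bd 6 c {2,4} = c {0,2,4} + c {1,2,4} - c {2,3,4} + c {2,4,5}"
  "bd 6 c {2,5} = c {0,2,5} + c {1,2,5} - c {2,3,5} - c {2,4,5}"
  "bd 6 c {3,4} = c {0,3,4} + c {1,3,4} + c {2,3,4} + c {3,4,5}"
  "bd 6 c {3,5} = c {0,3,5} + c {1,3,5} + c {2,3,5} - c {3,4,5}"
  "bd 6 c {4,5} = c {0,4,5} + c {1,4,5} + c {2,4,5} + c {3,4,5}"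
  by (simp_all add: bd_edge lessThan_6 insert_Diff_if del: One_nat_def) (simp_all add: insert_commute)

text \<open>A finite set determines its sorted list. This separates the triangles when
  \<open>rp2_chain\<close> is evaluated.\<close>

lemma sorted_triple_eq_iff:
  assumes "a < b" "b < c" "d < e" "e < (f :: nat)"
  shows "{a, b, c} = {d, e, f} \<longleftrightarrow> a = d \<and> b = e \<and> c = f"
proof -
  have "sorted_list_of_set {a, b, c} = [a, b, c]" "sorted_list_of_set {d, e, f} = [d, e, f]"
    using assms by (simp_all add: insert_Diff_if)
  then show ?thesis by (metis list.inject)
qed

lemma rp2_chain_values:
  "rp2_chain {0,1,2} = -1"
  "rp2_chain {0,1,3} = 2"
  "rp2_chain {0,1,4} = 0"
  "rp2_chain {0,1,5} = -1"
  "rp2_chain {0,2,3} = -1"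
  "rp2_chain {0,2,4} = 0"
  "rp2_chain {0,2,5} = 0"
  "rp2_chain {0,3,4} = 1"
  "rp2_chain {0,3,5} = 0"
  "rp2_chain {0,4,5} = 1"
  "rp2_chain {1,2,3} = 0"
  "rp2_chain {1,2,4} = 1"
  "rp2_chain {1,2,5} = 0"
  "rp2_chain {1,3,4} = -1"
  "rp2_chain {1,3,5} = -1"
  "rp2_chain {1,4,5} = 0"
  "rp2_chain {2,3,4} = 0"
  "rp2_chain {2,3,5} = 1"
  "rp2_chain {2,4,5} = -1"
  "rp2_chain {3,4,5} = 0"
  by (simp_all add: rp2_chain_def sorted_triple_eq_iff del: One_nat_def)

lemma rp2_chain_supp: "rp2_chain \<sigma> \<noteq> 0 \<Longrightarrow> \<sigma> \<in> {{0,1,3}, {0,3,4}, {0,4,5}, {1,2,4}, {2,3,5},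
    {0,1,2}, {0,2,3}, {0,1,5}, {1,3,4}, {2,4,5}, {1,3,5}}"
  by (rule ccontr) (simp add: rp2_chain_def del: One_nat_def)

lemma rp2_chain_triangle:
  assumes "rp2_chain \<sigma> \<noteq> 0"
  shows "\<sigma> \<subseteq> {..<6}" "card \<sigma> = 3"
proof -
  have "\<forall>\<sigma>\<in>{{0::nat,1,3}, {0,3,4}, {0,4,5}, {1,2,4}, {2,3,5},
      {0,1,2}, {0,2,3}, {0,1,5}, {1,3,4}, {2,4,5}, {1,3,5}}. \<sigma> \<subseteq> {..<6} \<and> card \<sigma> = 3"
    by (simp del: One_nat_def)
  from bspec[OF this rp2_chain_supp[OF assms]] show "\<sigma> \<subseteq> {..<6}" "card \<sigma> = 3"
    by (rule conjunct1, rule conjunct2)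
qed

lemma bd_rp2_chain: "bd 6 rp2_chain = (\<lambda>\<rho>. 0)"
proof
  fix \<rho>
  show "bd 6 rp2_chain \<rho> = 0"
  proof (cases "\<rho> \<subseteq> {..<6} \<and> card \<rho> = 2")
    case True
    have "\<forall>\<rho>\<in>{{0,1},{0,2},{0,3},{0,4},{0,5},{1,2},{1,3},{1,4},{1,5},{2,3},{2,4},{2,5},{3,4},{3,5},{4,5}}. bd 6 rp2_chain \<rho> = 0"
      by (simp add: bd_6_edges rp2_chain_values del: One_nat_def)
    then show ?thesis by (rule bspec) (use True in \<open>intro edge_cases; simp\<close>)
  next
    case False
    \<comment> \<open>A face that is not an edge on the six vertices is not contained in a triangle
      of the support as a facet.\<close>
    have "rp2_chain (insert v \<rho>) = 0" if "v \<notin> \<rho>" for v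
    proof (rule ccontr)
      assume "rp2_chain (insert v \<rho>) \<noteq> 0"
      note t = rp2_chain_triangle[OF this]
      then have "finite \<rho>" using finite_subset[OF t(1)] by simp
      then show False using t that False by simp
    qed
    then show ?thesis by (auto simp: bd_def intro: sum.neutral)
  qed
qed

text \<open>Nine of the twenty triangles lie outside the support. On the other eleven, the edge
  equations express every coefficient through that of \<open>{0,1,2}\<close>.\<close>

lemma circuit_rp2_chain: "circuit 2 6 rp2_chain"
  unfolding circuit_def
proof (intro conjI allI impI)
  show "supp rp2_chain \<subseteq> {\<sigma>. \<sigma> \<subseteq> {..<6} \<and> card \<sigma> = 2 + 1}"
    using rp2_chain_triangle by (auto simp: supp_def)
  fix c assume sub: "supp c \<subseteq> supp rp2_chain" and bd: "bd 6 c = (\<lambda>\<rho>. 0)"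
  have c0: "c \<sigma> = 0" if "rp2_chain \<sigma> = 0" for \<sigma> using sub that by (auto simp: supp_def)
  note z = c0[of "{0,1,4}", OF rp2_chain_values(3)]
    c0[of "{0,2,4}", OF rp2_chain_values(6)]
    c0[of "{0,2,5}", OF rp2_chain_values(7)]
    c0[of "{0,3,5}", OF rp2_chain_values(9)]
    c0[of "{1,2,3}", OF rp2_chain_values(11)]
    c0[of "{1,2,5}", OF rp2_chain_values(13)]
    c0[of "{1,4,5}", OF rp2_chain_values(16)]
    c0[of "{2,3,4}", OF rp2_chain_values(17)]
    c0[of "{3,4,5}", OF rp2_chain_values(20)]
  note eqs = bd_6_edges[of c, unfolded bd z]
  \<comment> \<open>Crossing an edge that lies in only two triangles of the support passes the
    coefficient from one to the other up to sign.\<close>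
  have v023: "c {0,2,3} = c {0,1,2}"
    using eqs(2) by simp
  have v124: "c {1,2,4} = - c {0,1,2}"
    using eqs(6) by simp
  have v134: "c {1,3,4} = c {0,1,2}"
    using eqs(8) v124 by simp
  have v235: "c {2,3,5} = - c {0,1,2}"
    using eqs(10) v023 by simp
  have v245: "c {2,4,5} = c {0,1,2}"
    using eqs(11) v124 by simp
  have v034: "c {0,3,4} = - c {0,1,2}"
    using eqs(13) v134 by simp
  \<comment> \<open>The edge \<open>{0,3}\<close> lies in three triangles of the support. The two
    projective-plane triangles contribute with equal sign, which produces the factor 2.\<close>
  have v013: "c {0,1,3} = -2 * c {0,1,2}"
    using eqs(3) v023 v034 by simp
  have v015: "c {0,1,5} = c {0,1,2}"
    using eqs(1) v013 by simp
  have v045: "c {0,4,5} = - c {0,1,2}"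
    using eqs(4) v034 by simp
  have v135: "c {1,3,5} = c {0,1,2}"
    using eqs(7) v134 v013 by simp
  \<comment> \<open>The minus sign appears because \<open>rp2_chain\<close> has coefficient -1 at
    \<open>{0,1,2}\<close>.\<close>
  have "\<forall>\<sigma>\<in>{{0::nat,1,3}, {0,3,4}, {0,4,5}, {1,2,4}, {2,3,5},
      {0,1,2}, {0,2,3}, {0,1,5}, {1,3,4}, {2,4,5}, {1,3,5}}. c \<sigma> = - c {0,1,2} * rp2_chain \<sigma>"
    by (simp add: v023 v124 v134 v235 v245 v034 v013 v015 v045 v135 rp2_chain_values del: One_nat_def)
  then have "c \<sigma> = - c {0,1,2} * rp2_chain \<sigma>" if "rp2_chain \<sigma> \<noteq> 0" for \<sigma>
    using rp2_chain_supp[OF that] by (rule bspec)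
  then have "c \<sigma> = - c {0,1,2} * rp2_chain \<sigma>" for \<sigma>
    using c0[of \<sigma>] by (cases "rp2_chain \<sigma> = 0") auto
  then show "\<exists>r. c = (\<lambda>\<sigma>. r * rp2_chain \<sigma>)" by blast
qed (rule bd_rp2_chain)

lemma ex_circuit:
  assumes "p \<ge> 2"
  shows "\<exists>m z \<sigma> \<tau>. circuit p m z \<and> \<bar>z \<sigma>\<bar> = 1 \<and> \<bar>z \<tau>\<bar> = 2"
  using assms
proof (induction p rule: dec_induct)
  case base
  have "\<bar>rp2_chain {0,1,2}\<bar> = 1" "\<bar>rp2_chain {0,1,3}\<bar> = 2" using rp2_chain_values(1,2) by simp_all
  then show ?case using circuit_rp2_chain by blast
next
  case (step p)
  then obtain m z \<sigma> \<tau> where z: "circuit p m z" "\<bar>z \<sigma>\<bar> = 1" "\<bar>z \<tau>\<bar> = 2" by blast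
  have "m \<notin> \<rho>" if "z \<rho> \<noteq> 0" for \<rho> using z(1) that by (auto simp: circuit_def supp_def)
  \<comment> \<open>Joining a simplex with \<open>m\<close> preserves its coefficient, so the
    absolute values 1 and 2 survive every suspension.\<close>
  then have e: "suspension m z (insert m \<rho>) = z \<rho>" if "z \<rho> \<noteq> 0" for \<rho>
    using that by (simp add: suspension_def)
  have "z \<sigma> \<noteq> 0" "z \<tau> \<noteq> 0" using z(2,3) by auto
  from e[OF this(1)] e[OF this(2)]
  have "\<bar>suspension m z (insert m \<sigma>)\<bar> = 1" "\<bar>suspension m z (insert m \<tau>)\<bar> = 2"
    using z(2,3) by simp_all
  then show ?case using circuit_suspension[OF z(1)] by blast
qed

section \<open>Quotients of dimension one\<close>

lemma vectorspace_dim_eq_1: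
  assumes "vectorspace K V" "v \<in> carrier V" "v \<noteq> \<zero>\<^bsub>V\<^esub>"
    and gen: "\<And>x. x \<in> carrier V \<Longrightarrow> \<exists>r\<in>carrier K. x = r \<odot>\<^bsub>V\<^esub> v"
  shows "vectorspace.dim K V = 1"
proof -
  interpret V: vectorspace K V by fact
  have v: "V.gen_set {v}"
  proof -
    have "V.lincomb a {v} = a v \<odot>\<^bsub>V\<^esub> v" if "a v \<in> carrier K" for a
      using assms(2) that by (simp add: V.lincomb_def)
    moreover have "V.span {v} = {V.lincomb a {v} |a. a \<in> {v} \<rightarrow> carrier K}"
      using assms(2) by (intro V.finite_span) simp_all
    ultimately have span: "V.span {v} = {a v \<odot>\<^bsub>V\<^esub> v |a. a v \<in> carrier K}"
      by (simp add: Pi_iff) (intro Collect_cong, metis)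
    show ?thesis
    proof (intro equalityI subsetI)
      fix x assume "x \<in> carrier V"
      then obtain r where "r \<in> carrier K" "x = r \<odot>\<^bsub>V\<^esub> v" using gen by blast
      then show "x \<in> V.span {v}" unfolding span by (intro CollectI exI[of _ "\<lambda>_. r"]) simp
    qed (use assms(2) span in \<open>auto\<close>)
  qed
  \<comment> \<open>The dimension is the least size of a finite generating set. The empty set spans
    only zero, which excludes size 0.\<close>
  have pos: "card A \<noteq> 0" if "finite A" "V.gen_set A" for A
  proof
    assume "card A = 0"
    then have "V.span {} = carrier V" using that by simp
    then have "carrier V \<subseteq> {\<zero>\<^bsub>V\<^esub>}" by (auto simp: V.span_def V.lincomb_def)
    then show False using assms by blast
  qed
  show ?thesis
    unfolding V.dim_def
  proof (rule Least_equality)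
    show "\<exists>A. finite A \<and> card A = 1 \<and> A \<subseteq> carrier V \<and> V.gen_set A"
      using v assms(2) by (intro exI[of _ "{v}"]) simp
  qed (use pos in \<open>metis less_one not_le_imp_less\<close>)
qed

text \<open>Phrased with a generator rather than a dimension so that it can be iterated on the
  quotient.\<close>

lemma quot_space_generator:
  assumes "vectorspace K V" "VectorSpace.subspace K W V" "v \<in> carrier V" "v \<notin> W"
    and gen: "\<And>x. x \<in> carrier V \<Longrightarrow> \<exists>r\<in>carrier K. \<exists>w\<in>W. x = w \<oplus>\<^bsub>V\<^esub> r \<odot>\<^bsub>V\<^esub> v"
  shows "\<exists>q\<in>carrier (quot_space V W). q \<noteq> \<zero>\<^bsub>quot_space V W\<^esub> \<and>
    (\<forall>x\<in>carrier (quot_space V W). \<exists>r\<in>carrier K. x = r \<odot>\<^bsub>quot_space V W\<^esub> q)"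
proof (intro bexI[of _ "W +>\<^bsub>V\<^esub> v"] conjI ballI)
  interpret V: vectorspace K V by fact
  interpret S: abelian_subgroup W V by (rule subspace_imp_abelian_subgroup[OF assms(1,2)])
  have car: "carrier (quot_space V W) = (\<lambda>x. W +>\<^bsub>V\<^esub> x) ` carrier V"
    by (auto simp: quot_space_def A_RCOSETS_def')
  show "W +>\<^bsub>V\<^esub> v \<in> carrier (quot_space V W)" using assms(3) car by simp
  show "W +>\<^bsub>V\<^esub> v \<noteq> \<zero>\<^bsub>quot_space V W\<^esub>"
    using assms(3,4) S.a_rcos_self by (auto simp: quot_space_def)
  fix x assume "x \<in> carrier (quot_space V W)"
  then obtain y where y: "y \<in> carrier V" "x = W +>\<^bsub>V\<^esub> y" using car by auto
  then obtain r w where r: "r \<in> carrier K" "w \<in> W" "y = w \<oplus>\<^bsub>V\<^esub> r \<odot>\<^bsub>V\<^esub> v" using gen by blast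
  then have "y \<in> W +>\<^bsub>V\<^esub> (r \<odot>\<^bsub>V\<^esub> v)" by (auto simp: a_r_coset_def')
  then have "x = W +>\<^bsub>V\<^esub> (r \<odot>\<^bsub>V\<^esub> v)"
    using y r(1) assms(3) by (metis S.a_repr_independence' V.smult_closed)
  then show "\<exists>r\<in>carrier K. x = r \<odot>\<^bsub>quot_space V W\<^esub> (W +>\<^bsub>V\<^esub> v)"
    using coset_smult[OF assms(1,2) r(1) assms(3)] r(1) by (auto simp: quot_space_def)
qed

lemma subspace_zero:
  assumes "vectorspace K V"
  shows "VectorSpace.subspace K {\<zero>\<^bsub>V\<^esub>} V"
proof -
  interpret V: vectorspace K V by fact
  show ?thesis
    unfolding VectorSpace.subspace_def
    by (intro conjI assms V.module_axioms submodule.intro) auto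
qed

text \<open>The first quotient will be homology. The second, by the zero subspace, is the form that
  \<open>P_space\<close> takes at infinity when the filtration starts with the empty
  complex.\<close>

lemma dim_quot_space_eq_1:
  assumes "vectorspace K V" "VectorSpace.subspace K W V" "v \<in> carrier V" "v \<notin> W"
    and gen: "\<And>x. x \<in> carrier V \<Longrightarrow> \<exists>r\<in>carrier K. \<exists>w\<in>W. x = w \<oplus>\<^bsub>V\<^esub> r \<odot>\<^bsub>V\<^esub> v"
  shows "vectorspace.dim K (quot_space V W) = 1"
    and "vectorspace.dim K (quot_space (quot_space V W) {\<zero>\<^bsub>quot_space V W\<^esub>}) = 1"
proof -
  let ?Q = "quot_space V W"
  have Q: "vectorspace K ?Q" by (rule vectorspace_quot_space[OF assms(1,2)])
  then interpret Q: vectorspace K ?Q .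
  note Z = subspace_zero[OF Q]
  obtain q where q: "q \<in> carrier ?Q" "q \<noteq> \<zero>\<^bsub>?Q\<^esub>"
    "\<forall>x\<in>carrier ?Q. \<exists>r\<in>carrier K. x = r \<odot>\<^bsub>?Q\<^esub> q"
    using quot_space_generator[OF assms] by blast
  show "vectorspace.dim K ?Q = 1" using q by (intro vectorspace_dim_eq_1[OF Q]) blast+
  have gen': "\<exists>r\<in>carrier K. \<exists>w\<in>{\<zero>\<^bsub>?Q\<^esub>}. x = w \<oplus>\<^bsub>?Q\<^esub> r \<odot>\<^bsub>?Q\<^esub> q" if "x \<in> carrier ?Q" for x
    using bspec[OF q(3) that] q(1) that by (metis Q.M.l_zero singletonI)
  have "q \<notin> {\<zero>\<^bsub>?Q\<^esub>}" using q(2) by simp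
  then obtain q' where "q' \<in> carrier (quot_space ?Q {\<zero>\<^bsub>?Q\<^esub>})" "q' \<noteq> \<zero>\<^bsub>quot_space ?Q {\<zero>\<^bsub>?Q\<^esub>}\<^esub>"
    "\<forall>x\<in>carrier (quot_space ?Q {\<zero>\<^bsub>?Q\<^esub>}). \<exists>r\<in>carrier K. x = r \<odot>\<^bsub>quot_space ?Q {\<zero>\<^bsub>?Q\<^esub>}\<^esub> q'"
    using quot_space_generator[OF Q Z q(1) _ gen'] by blast
  then show "vectorspace.dim K (quot_space ?Q {\<zero>\<^bsub>?Q\<^esub>}) = 1"
    by (intro vectorspace_dim_eq_1[OF vectorspace_quot_space[OF Q Z]]) blast+
qed

section \<open>Homology and harmonic chains of two-step filtrations\<close>

definition lin_closed :: "chain set \<Rightarrow> bool" where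
  "lin_closed U \<longleftrightarrow> (\<lambda>\<sigma>. 0) \<in> U \<and> (\<forall>c\<in>U. \<forall>d\<in>U. \<forall>r. (\<lambda>\<sigma>. c \<sigma> + r * d \<sigma>) \<in> U)"

lemma lin_closedD:
  assumes "lin_closed U"
  shows "(\<lambda>\<sigma>. 0) \<in> U"
    and "c \<in> U \<Longrightarrow> d \<in> U \<Longrightarrow> (\<lambda>\<sigma>. c \<sigma> + r * d \<sigma>) \<in> U"
    and "c \<in> U \<Longrightarrow> d \<in> U \<Longrightarrow> (\<lambda>\<sigma>. c \<sigma> + d \<sigma>) \<in> U"
    and "c \<in> U \<Longrightarrow> d \<in> U \<Longrightarrow> (\<lambda>\<sigma>. c \<sigma> - d \<sigma>) \<in> U"
    and "d \<in> U \<Longrightarrow> (\<lambda>\<sigma>. r * d \<sigma>) \<in> U"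
proof -
  show 0: "(\<lambda>\<sigma>. 0) \<in> U" using assms by (simp add: lin_closed_def)
  show 1: "(\<lambda>\<sigma>. c \<sigma> + r * d \<sigma>) \<in> U" if "c \<in> U" "d \<in> U" for c d r
    using assms that by (simp add: lin_closed_def)
  show "(\<lambda>\<sigma>. c \<sigma> + d \<sigma>) \<in> U" if "c \<in> U" "d \<in> U" using 1[OF that, of 1] by simp
  show "(\<lambda>\<sigma>. c \<sigma> - d \<sigma>) \<in> U" if "c \<in> U" "d \<in> U" using 1[OF that, of "-1"] by simp
  show "(\<lambda>\<sigma>. r * d \<sigma>) \<in> U" if "d \<in> U" using 1[OF 0 that, of r] by simp
qed

lemma vectorspace_chains:
  assumes "lin_closed U"
  shows "vectorspace class_ring ((chain_space p K)\<lparr>carrier := U\<rparr>)"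
proof (rule vs_criteria)
  have "(\<lambda>\<sigma>. - c \<sigma>) \<in> U" if "c \<in> U" for c using lin_closedD(5)[OF assms that, of "-1"] by simp
  then show "\<forall>c\<in>carrier ((chain_space p K)\<lparr>carrier := U\<rparr>). \<exists>d\<in>carrier ((chain_space p K)\<lparr>carrier := U\<rparr>).
      c \<oplus>\<^bsub>(chain_space p K)\<lparr>carrier := U\<rparr>\<^esub> d = \<zero>\<^bsub>(chain_space p K)\<lparr>carrier := U\<rparr>\<^esub>"
    by (intro ballI bexI[of _ "\<lambda>\<sigma>. - _ \<sigma>"]) (auto simp: chain_space_def)
qed (auto simp: class_field chain_space_def algebra_simps intro: lin_closedD[OF assms])

lemma subspace_chains:
  assumes "lin_closed U" "lin_closed W" "W \<subseteq> U"
  shows "VectorSpace.subspace class_ring W ((chain_space p K)\<lparr>carrier := U\<rparr>)"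
proof -
  interpret vectorspace class_ring "(chain_space p K)\<lparr>carrier := U\<rparr>" by (rule vectorspace_chains[OF assms(1)])
  show ?thesis
    unfolding VectorSpace.subspace_def
    by (intro conjI vectorspace_chains[OF assms(1)] submodule.intro module_axioms)
      (use assms(3) in \<open>auto simp: chain_space_def intro: lin_closedD[OF assms(2)]\<close>)
qed

lemma boundary_add_smult:
  "boundary p K (\<lambda>\<sigma>. c \<sigma> + r * d \<sigma>) = (\<lambda>\<sigma>. boundary p K c \<sigma> + r * boundary p K d \<sigma>)"
  by (simp add: boundary_def fun_eq_iff algebra_simps sum.distrib sum_distrib_left)

lemma boundary_zero: "boundary p K (\<lambda>\<sigma>. 0) = (\<lambda>\<sigma>. 0)"
  by (simp add: boundary_def)

lemma carrier_chain_space: "c \<in> carrier (chain_space p K) \<longleftrightarrow> (\<forall>\<sigma>. \<sigma> \<notin> simplices p K \<longrightarrow> c \<sigma> = 0)"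
  by (auto simp: chain_space_def supp_def)

lemma lin_closed_chain_space: "lin_closed (carrier (chain_space p K))"
  by (simp add: lin_closed_def carrier_chain_space)

lemma lin_closed_cycles: "lin_closed (cycles p K)"
  using lin_closed_chain_space[of p K]
  by (auto simp: lin_closed_def cycles_def boundary_add_smult boundary_zero)

lemma lin_closed_boundaries: "lin_closed (boundaries p K)"
proof -
  have "(\<lambda>\<sigma>. 0) \<in> boundaries p K"
    unfolding boundaries_def
    by (rule image_eqI[where x = "\<lambda>\<sigma>. 0"]) (simp_all add: boundary_zero carrier_chain_space)
  moreover have "(\<lambda>\<sigma>. b \<sigma> + r * c \<sigma>) \<in> boundaries p K"
    if bc: "b \<in> boundaries p K" "c \<in> boundaries p K" for b c r
  proof -
    obtain b' c' where "b' \<in> carrier (chain_space (p + 1) K)" "b = boundary (p + 1) K b'"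
      "c' \<in> carrier (chain_space (p + 1) K)" "c = boundary (p + 1) K c'"
      using bc by (auto simp: boundaries_def)
    then show ?thesis
      unfolding boundaries_def
      by (intro image_eqI[where x = "\<lambda>\<sigma>. b' \<sigma> + r * c' \<sigma>"])
        (simp_all add: boundary_add_smult lin_closedD(2)[OF lin_closed_chain_space])
  qed
  ultimately show ?thesis by (simp add: lin_closed_def)
qed

lemma finite_complex_bound:
  assumes "finite_complex K"
  obtains m where "K \<subseteq> Pow {..<m}"
proof -
  obtain m where "K \<subseteq> Pow {0..m}" using assms by (auto simp: finite_complex_def)
  also have "Pow {0..m} \<subseteq> Pow {..<Suc m}" by (auto simp: less_Suc_eq_le)
  finally show ?thesis by (rule that)
qed

text \<open>The operator \<open>bd\<close> represents the boundary in both degrees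
  \<open>p + 1\<close> and \<open>p\<close>, so \<open>bd_bd\<close> applies. Closure under faces
  keeps the boundary inside the chains of \<open>K\<close>.\<close>

lemma boundaries_subset_cycles:
  assumes K: "finite_complex K" and p: "p > 0"
  shows "boundaries p K \<subseteq> cycles p K"
proof
  fix b assume "b \<in> boundaries p K"
  then obtain c where c: "c \<in> carrier (chain_space (p + 1) K)" "b = boundary (p + 1) K c"
    by (auto simp: boundaries_def)
  obtain m where m: "K \<subseteq> Pow {..<m}" by (rule finite_complex_bound[OF K])
  have b: "b = bd m c" using boundary_eq_bd[OF m _ c(1)] c(2) by simp
  have fin: "finite \<sigma>" "\<sigma> \<in> simplices (p + 1) K" if "c \<sigma> \<noteq> 0" for \<sigma>
    using c(1) m that by (auto simp: carrier_chain_space simplices_def dest: finite_subset)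
  have "\<rho> \<in> simplices p K" if "b \<rho> \<noteq> 0" for \<rho>
  proof -
    have "\<exists>v\<in>{..<m} - \<rho>. c (insert v \<rho>) \<noteq> 0"
      using that unfolding b bd_def by (rule contrapos_np) simp
    then obtain v where v: "v \<notin> \<rho>" "c (insert v \<rho>) \<noteq> 0" by blast
    then have "\<rho> \<in> K" using fin(2)[OF v(2)] K unfolding simplices_def finite_complex_def by blast
    then show ?thesis using fin[OF v(2)] v(1) by (simp add: simplices_def)
  qed
  then have bC: "b \<in> carrier (chain_space p K)" by (auto simp: carrier_chain_space)
  then have "boundary p K b = bd m (bd m c)" using boundary_eq_bd[OF m p] b by simp
  then show "b \<in> cycles p K" using bC bd_bd[of c m] fin(1) by (simp add: cycles_def)
qed

section \<open>Homology classes and induced maps\<close>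

lemma mem_hom_class: "x \<in> hom_class p K y \<longleftrightarrow> (\<lambda>\<sigma>. x \<sigma> - y \<sigma>) \<in> boundaries p K"
proof -
  have "x \<in> hom_class p K y \<longleftrightarrow> (\<exists>b\<in>boundaries p K. x = (\<lambda>\<sigma>. b \<sigma> + y \<sigma>))"
    by (auto simp: hom_class_def a_r_coset_def' chain_space_def)
  also have "\<dots> \<longleftrightarrow> (\<lambda>\<sigma>. x \<sigma> - y \<sigma>) \<in> boundaries p K"
  proof
    assume "(\<lambda>\<sigma>. x \<sigma> - y \<sigma>) \<in> boundaries p K"
    then show "\<exists>b\<in>boundaries p K. x = (\<lambda>\<sigma>. b \<sigma> + y \<sigma>)" by (rule bexI[rotated]) simp
  qed auto
  finally show ?thesis .
qed

lemma hom_class_self: "x \<in> hom_class p K x"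
  by (simp add: mem_hom_class lin_closedD(1)[OF lin_closed_boundaries])

lemma hom_class_eq:
  assumes "x \<in> hom_class p K y"
  shows "hom_class p K x = hom_class p K y"
proof -
  have d: "(\<lambda>\<sigma>. x \<sigma> - y \<sigma>) \<in> boundaries p K" using assms by (simp add: mem_hom_class)
  have "w \<in> hom_class p K x \<longleftrightarrow> w \<in> hom_class p K y" for w
    using lin_closedD(3)[OF lin_closed_boundaries _ d, of "\<lambda>\<sigma>. w \<sigma> - x \<sigma>"]
      lin_closedD(4)[OF lin_closed_boundaries _ d, of "\<lambda>\<sigma>. w \<sigma> - y \<sigma>"]
    by (auto simp: mem_hom_class)
  then show ?thesis by blast
qed

lemma hom_class_eq_boundaries_iff: "hom_class p K x = boundaries p K \<longleftrightarrow> x \<in> boundaries p K"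
proof
  assume "hom_class p K x = boundaries p K"
  then show "x \<in> boundaries p K" using hom_class_self[of x p K] by simp
next
  assume x: "x \<in> boundaries p K"
  have "w \<in> hom_class p K x \<longleftrightarrow> w \<in> boundaries p K" for w
    using lin_closedD(3)[OF lin_closed_boundaries _ x, of "\<lambda>\<sigma>. w \<sigma> - x \<sigma>"]
      lin_closedD(4)[OF lin_closed_boundaries _ x, of w]
    by (auto simp: mem_hom_class)
  then show "hom_class p K x = boundaries p K" by blast
qed

lemma carrier_homology: "carrier (homology p K) = hom_class p K ` cycles p K"
  by (auto simp: homology_def quot_space_def A_RCOSETS_def' hom_class_def a_r_coset_def')

lemma zero_homology: "\<zero>\<^bsub>homology p K\<^esub> = boundaries p K"
  by (simp add: homology_def quot_space_def)

lemma hom_induced_self: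
  assumes "x \<in> carrier (homology p K)"
  shows "hom_induced p K K x = x"
proof -
  obtain z where z: "x = hom_class p K z" using assms by (auto simp: carrier_homology)
  then have "hom_class p K y = x" if "y \<in> x" for y using hom_class_eq that by simp
  moreover have "z \<in> x" using z hom_class_self by simp
  ultimately have "hom_class p K ` x = {x}" by (auto intro: rev_image_eqI)
  then show ?thesis by (simp add: hom_induced_def)
qed

section \<open>Barcodes of filtrations that start with the empty complex\<close>

lemma simplices_empty: "simplices p {} = {}"
  by (simp add: simplices_def)

lemma carrier_chain_space_empty: "carrier (chain_space p {}) = {\<lambda>\<sigma>. 0}"
  by (auto simp: carrier_chain_space simplices_empty set_eq_iff)

lemma cycles_empty: "cycles p {} = {\<lambda>\<sigma>. 0}"
  by (auto simp: cycles_def carrier_chain_space_empty boundary_zero)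

lemma boundaries_empty: "boundaries p {} = {\<lambda>\<sigma>. 0}"
  by (simp add: boundaries_def carrier_chain_space_empty boundary_zero)

lemma harmonic_empty: "harmonic p {} = {\<lambda>\<sigma>. 0}"
  by (auto simp: harmonic_def cycles_empty orth_def carrier_chain_space_empty chain_inner_def)

lemma hom_image_empty: "hom_image p {} K = {boundaries p K}"
proof -
  have "hom_class p {} (\<lambda>\<sigma>. 0) = {\<lambda>\<sigma>. 0}"
    using hom_class_eq_boundaries_iff[of p "{}" "\<lambda>\<sigma>. 0"] by (simp add: boundaries_empty)
  moreover have "hom_class p K (\<lambda>\<sigma>. 0) = boundaries p K"
    by (simp add: hom_class_eq_boundaries_iff lin_closedD(1)[OF lin_closed_boundaries])
  ultimately show ?thesis
    by (simp add: hom_image_def carrier_homology cycles_empty hom_induced_def)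
qed

text \<open>The map from \<open>K\<close> to itself is the identity on homology, and the empty
  complex contributes only the zero class.\<close>

lemma M_space_two_step:
  "M_space p [{}, K] 1 1 = {boundaries p K}"
proof -
  have "boundaries p K \<in> carrier (homology p K)"
    unfolding carrier_homology
    by (rule image_eqI[where x = "\<lambda>\<sigma>. 0"])
      (simp_all add: hom_class_eq_boundaries_iff[THEN iffD2] lin_closedD(1) lin_closed_boundaries
        lin_closed_cycles)
  moreover have "M_space p [{}, K] 1 1 =
      {x \<in> carrier (homology p K). hom_induced p K K x = boundaries p K}"
    by (simp add: M_space_def prev_def hom_image_empty)
  ultimately show ?thesis using hom_induced_self by auto
qed

lemma last_time_two_step: "last_time [{}, K] = 1"
  by (simp add: last_time_def)

lemma Rep_two_step:
  "Rep p [{}, K] (1, \<infinity>, 1) = cycles p K - boundaries p K"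
  by (auto simp: Rep_def M_cycles_def last_time_two_step M_space_two_step hom_class_eq_boundaries_iff
      simp del: One_nat_def)

lemma multiplicity_two_step:
  "multiplicity p [{}, K] 1 \<infinity> = real_dim (quot_space (homology p K) {boundaries p K})"
  by (simp add: multiplicity_def P_space_def last_time_two_step M_space_two_step del: One_nat_def)

lemma rank_one_homology:
  assumes K: "finite_complex K" "p > 0" and z: "z \<in> cycles p K" "z \<notin> boundaries p K"
    and gen: "\<And>c. c \<in> cycles p K \<Longrightarrow> \<exists>r. (\<lambda>\<sigma>. c \<sigma> - r * z \<sigma>) \<in> boundaries p K"
  shows "real_dim (homology p K) = 1" "multiplicity p [{}, K] 1 \<infinity> = 1"
proof -
  let ?V = "(chain_space p K)\<lparr>carrier := cycles p K\<rparr>"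
  note V = vectorspace_chains[OF lin_closed_cycles, of p K]
  note B = subspace_chains[OF lin_closed_cycles lin_closed_boundaries boundaries_subset_cycles[OF K], of p K]
  have z': "z \<in> carrier ?V" using z by simp
  have gen': "\<exists>r\<in>carrier class_ring. \<exists>w\<in>boundaries p K. c = w \<oplus>\<^bsub>?V\<^esub> r \<odot>\<^bsub>?V\<^esub> z" if c: "c \<in> carrier ?V" for c
  proof -
    obtain r where "(\<lambda>\<sigma>. c \<sigma> - r * z \<sigma>) \<in> boundaries p K" using gen c by auto
    then show ?thesis
      by (intro bexI[of _ r] bexI[of _ "\<lambda>\<sigma>. c \<sigma> - r * z \<sigma>"]) (auto simp: chain_space_def)
  qed
  note dims = dim_quot_space_eq_1[OF V B z' z(2) gen']
  show "real_dim (homology p K) = 1" using dims(1) by (simp only: homology_def)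
  show "multiplicity p [{}, K] 1 \<infinity> = 1"
    using dims(2) by (simp only: multiplicity_two_step homology_def[symmetric] zero_homology)
qed

section \<open>Orthogonality and harmonic representatives\<close>

lemma chain_inner_self_eq_0:
  assumes "finite_complex K" "c \<in> carrier (chain_space p K)" "chain_inner p K c c = 0"
  shows "c = (\<lambda>\<sigma>. 0)"
proof
  fix \<sigma>
  obtain m where "K \<subseteq> Pow {..<m}" by (rule finite_complex_bound[OF assms(1)])
  then have "finite (simplices p K)"
    by (intro finite_subset[of "simplices p K" "Pow {..<m}"]) (auto simp: simplices_def)
  then have "c \<sigma> * c \<sigma> = 0" if "\<sigma> \<in> simplices p K"
    using assms(3) that by (subst (asm) chain_inner_def) (simp add: sum_nonneg_eq_0_iff)
  then show "c \<sigma> = 0" using assms(2) by (cases "\<sigma> \<in> simplices p K") (auto simp: carrier_chain_space)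
qed

lemma chain_inner_add_smult:
  "chain_inner p K (\<lambda>\<sigma>. c \<sigma> + r * d \<sigma>) u = chain_inner p K c u + r * chain_inner p K d u"
  by (simp add: chain_inner_def algebra_simps sum.distrib sum_distrib_left)

lemma chain_inner_zero: "chain_inner p K (\<lambda>\<sigma>. 0) u = 0"
  by (simp add: chain_inner_def)

lemma lin_closed_orth: "lin_closed (orth p K U)"
  using lin_closed_chain_space[of p K]
  by (simp add: lin_closed_def orth_def chain_inner_add_smult chain_inner_zero)

text \<open>The projection is a definite description, so uniqueness has to be shown: the difference
  of \<open>z\<close> and another candidate lies in a space and in its orthogonal complement, and is
  therefore orthogonal to itself.\<close>

lemma harm_map_self:
  assumes K: "finite_complex K" and z: "z \<in> orth p K (boundaries p K)"
  shows "harm_map p K z = z"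
  unfolding harm_map_def orth_proj_def
proof (rule the_equality)
  show "z \<in> orth p K (boundaries p K) \<and> (\<lambda>\<sigma>. z \<sigma> - z \<sigma>) \<in> orth p K (orth p K (boundaries p K))"
    using z lin_closedD(1)[OF lin_closed_orth] by simp
  fix u assume u: "u \<in> orth p K (boundaries p K) \<and> (\<lambda>\<sigma>. z \<sigma> - u \<sigma>) \<in> orth p K (orth p K (boundaries p K))"
  then have "(\<lambda>\<sigma>. z \<sigma> - u \<sigma>) \<in> orth p K (boundaries p K)"
    using z lin_closedD(4)[OF lin_closed_orth] by blast
  then have "(\<lambda>\<sigma>. z \<sigma> - u \<sigma>) = (\<lambda>\<sigma>. 0)"
    using u by (intro chain_inner_self_eq_0[OF K, where p = p]) (auto simp: orth_def)
  then show "u = z" by (simp add: fun_eq_iff)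
qed

text \<open>The projection fixes harmonic chains, and only zero comes from the empty complex. Hence
  \<open>harm_M\<close> contains at most zero, and orthogonality to it is no restriction.\<close>

lemma harm_P_two_step:
  assumes "finite_complex K"
  shows "harm_P p [{}, K] 1 \<infinity> = harmonic p K"
proof -
  have "harm_map p K z = z" if "z \<in> harmonic p K" for z
    using that harm_map_self[OF assms] by (simp add: harmonic_def)
  moreover have "harm_map p K (\<lambda>\<sigma>. 0) = (\<lambda>\<sigma>. 0)"
    using harm_map_self[OF assms] lin_closedD(1)[OF lin_closed_orth] by blast
  ultimately have "harm_M p [{}, K] 1 1 \<subseteq> {\<lambda>\<sigma>. 0}"
    by (auto simp: harm_M_def prev_def harmonic_empty)
  then have "harmonic p K \<subseteq> orth p K (harm_M p [{}, K] 1 1)"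
    by (auto simp: harmonic_def orth_def chain_inner_def)
  then show ?thesis by (auto simp: harm_P_def last_time_two_step simp del: One_nat_def)
qed

lemma generic_bar_two_step:
  assumes "multiplicity p [{}, K] 1 \<infinity> = 1"
  shows "(1, \<infinity>, 1) \<in> barcode p [{}, K]" "generic_bar p [{}, K] (1, \<infinity>, 1)"
    "simple_bar p [{}, K] (1, \<infinity>, 1)"
proof -
  show b: "(1, \<infinity>, 1) \<in> barcode p [{}, K]"
    unfolding barcode_def using assms
    by (intro CollectI exI[of _ 1] exI[of _ \<infinity>]) (simp_all add: last_time_def ext_times_def)
  then show s: "simple_bar p [{}, K] (1, \<infinity>, 1)" using assms by (simp add: simple_bar_def)
  \<comment> \<open>The last finite time is 1, so infinity is the only possible death time and no
    competing bar exists.\<close>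
  have "t' = \<infinity>" if "t' \<in> ext_times [{}, K]" "enat 1 < t'" for t'
    using that by (auto simp: ext_times_def last_time_def one_enat_def)
  then show "generic_bar p [{}, K] (1, \<infinity>, 1)" using s by (auto simp: generic_bar_def)
qed

section \<open>Coning off one simplex of a circuit\<close>

lemma bd_smult: "bd m (\<lambda>\<rho>. r * c \<rho>) = (\<lambda>\<rho>. r * bd m c \<rho>)"
  using bd_add_smult[of m "\<lambda>_. 0" r c] by simp

text \<open>Only \<open>v\<close> completes the facet to \<open>\<Delta>\<close>, so the coefficient
  is a single incidence sign.\<close>

lemma abs_bd_single:
  assumes "\<Delta> \<subseteq> {..<m}" "v \<in> \<Delta>"
  shows "\<bar>bd m (single \<Delta>) (\<Delta> - {v})\<bar> = 1"
proof -
  have "insert u (\<Delta> - {v}) \<noteq> \<Delta>" if "u \<in> {..<m} - (\<Delta> - {v}) - {v}" for u using that by auto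
  then have "bd m (single \<Delta>) (\<Delta> - {v}) =
      (\<Sum>u\<in>{v}. inc_sign (\<Delta> - {v}) u * single \<Delta> (insert u (\<Delta> - {v})))"
    unfolding bd_def using assms by (intro sum.mono_neutral_right) (auto simp: single_def)
  also have "\<dots> = inc_sign (\<Delta> - {v}) v" using assms by (simp add: single_def insert_absorb)
  finally show ?thesis by simp
qed

lemma bd_single_nonzero:
  assumes "bd m (single \<Delta>) \<rho> \<noteq> 0"
  shows "\<exists>v\<in>\<Delta>. \<rho> = \<Delta> - {v}"
proof -
  have "\<exists>v\<in>{..<m} - \<rho>. insert v \<rho> = \<Delta>"
    using assms unfolding bd_def by (rule contrapos_np) (auto simp: single_def intro!: sum.neutral)
  then obtain v where "v \<notin> \<rho>" "insert v \<rho> = \<Delta>" by blast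
  then show ?thesis by (intro bexI[of _ v]) auto
qed

text \<open>The simplex \<open>cap\<close> is glued to the support of \<open>z\<close> along its facet \<open>\<tau>\<close>; it is the only
  \<open>(n + 1)\<close>-simplex, so the space of \<open>n\<close>-boundaries is a line.\<close>

locale capped_circuit =
  fixes n m :: nat and z :: chain and \<tau> :: "nat set"
  assumes n: "n > 0" and circuit: "circuit n m z" and z_\<tau>: "z \<tau> \<noteq> 0"
begin

definition cap :: "nat set" where "cap = insert m \<tau>"

definition cap_bd :: chain where "cap_bd = bd (Suc m) (single cap)"

definition J :: scomplex where "J = {\<rho>. \<exists>F\<in>insert cap (supp z). \<rho> \<subseteq> F}"

lemma z_supp:
  assumes "z \<rho> \<noteq> 0"
  shows "\<rho> \<subseteq> {..<m}" "card \<rho> = n + 1" "finite \<rho>" "m \<notin> \<rho>"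
proof -
  show 1: "\<rho> \<subseteq> {..<m}" "card \<rho> = n + 1" using circuit assms by (auto simp: circuit_def supp_def)
  show "finite \<rho>" using 1(1) by (rule finite_subset) simp
  show "m \<notin> \<rho>" using 1(1) by auto
qed

lemmas \<tau>_props = z_supp[OF z_\<tau>]

lemma cap_props: "cap \<subseteq> {..<Suc m}" "card cap = n + 2" "finite cap" "m \<in> cap" "cap - {m} = \<tau>"
  using \<tau>_props by (auto simp: cap_def)

lemma abs_cap_bd: "v \<in> cap \<Longrightarrow> \<bar>cap_bd (cap - {v})\<bar> = 1"
  unfolding cap_bd_def by (rule abs_bd_single[OF cap_props(1)])

lemma abs_cap_bd_\<tau>: "\<bar>cap_bd \<tau>\<bar> = 1"
  using abs_cap_bd[OF cap_props(4)] cap_props(5) by simp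

lemma cap_bd_nonzero: "cap_bd \<rho> \<noteq> 0 \<Longrightarrow> \<exists>v\<in>cap. \<rho> = cap - {v}"
  unfolding cap_bd_def by (rule bd_single_nonzero)

lemma cap_bd_zero: "m \<notin> \<rho> \<Longrightarrow> \<rho> \<noteq> \<tau> \<Longrightarrow> cap_bd \<rho> = 0"
  using cap_bd_nonzero[of \<rho>] cap_props(4,5) by (cases "cap_bd \<rho> = 0") auto

lemma J_bound: "J \<subseteq> Pow {..<Suc m}"
proof
  fix \<rho> assume "\<rho> \<in> J"
  then obtain F where "F = cap \<or> z F \<noteq> 0" "\<rho> \<subseteq> F" by (auto simp: J_def supp_def)
  then have "F \<subseteq> {..<Suc m}" using cap_props(1) z_supp(1)[of F] by (auto simp: less_Suc_eq)
  then show "\<rho> \<in> Pow {..<Suc m}" using \<open>\<rho> \<subseteq> F\<close> by blast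
qed

lemma finite_complex_J: "finite_complex J"
proof -
  have "J \<subseteq> Pow {0..m}" using J_bound by (simp add: lessThan_Suc_atMost atLeast0AtMost)
  moreover have "\<forall>\<sigma>\<in>J. \<forall>\<rho>. \<rho> \<subseteq> \<sigma> \<longrightarrow> \<rho> \<in> J" unfolding J_def by (blast intro: subset_trans)
  ultimately show ?thesis unfolding finite_complex_def by blast
qed

lemma card_J:
  assumes "\<rho> \<in> J"
  shows "\<rho> = cap \<or> (\<exists>v\<in>cap. \<rho> \<subseteq> cap - {v}) \<or> (\<exists>F. z F \<noteq> 0 \<and> \<rho> \<subseteq> F)" "card \<rho> \<le> n + 2"
proof -
  obtain F where F: "F = cap \<or> z F \<noteq> 0" "\<rho> \<subseteq> F" using assms by (auto simp: J_def supp_def)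
  then show "\<rho> = cap \<or> (\<exists>v\<in>cap. \<rho> \<subseteq> cap - {v}) \<or> (\<exists>F. z F \<noteq> 0 \<and> \<rho> \<subseteq> F)" by blast
  have "finite F" "card F \<le> n + 2" using F(1) cap_props z_supp[of F] by auto
  then show "card \<rho> \<le> n + 2" using card_mono[OF _ F(2)] by simp
qed

text \<open>A face with \<open>n + 1\<close> vertices of a simplex of \<open>z\<close> is that
  simplex; such a face of \<open>cap\<close> is a facet. The two families share only
  \<open>\<tau>\<close>, since the other facets of \<open>cap\<close> contain
  \<open>m\<close>.\<close>

lemma simplices_n: "simplices n J = supp z \<union> (\<lambda>v. cap - {v}) ` cap"
proof (intro equalityI subsetI)
  fix \<rho> assume "\<rho> \<in> simplices n J"
  then have \<rho>: "\<rho> \<in> J" "card \<rho> = n + 1" by (auto simp: simplices_def)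
  consider "\<rho> = cap" | v where "v \<in> cap" "\<rho> \<subseteq> cap - {v}" | F where "z F \<noteq> 0" "\<rho> \<subseteq> F"
    using card_J(1)[OF \<rho>(1)] by blast
  then show "\<rho> \<in> supp z \<union> (\<lambda>v. cap - {v}) ` cap"
  proof cases
    case 1
    then show ?thesis using cap_props(2) \<rho>(2) by simp
  next
    case 2
    then have "\<rho> = cap - {v}" using cap_props(2,3) \<rho>(2) by (intro card_subset_eq) auto
    then show ?thesis using 2(1) by blast
  next
    case 3
    then have "\<rho> = F" using z_supp(2,3)[OF 3(1)] \<rho>(2) by (intro card_subset_eq) auto
    then show ?thesis using 3(1) by (simp add: supp_def)
  qed
next
  fix \<rho> assume "\<rho> \<in> supp z \<union> (\<lambda>v. cap - {v}) ` cap"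
  then consider "z \<rho> \<noteq> 0" | v where "v \<in> cap" "\<rho> = cap - {v}" by (auto simp: supp_def)
  then show "\<rho> \<in> simplices n J"
  proof cases
    case 1
    then show ?thesis using z_supp(2) by (auto simp: simplices_def J_def supp_def)
  next
    case 2
    then show ?thesis using cap_props(2,3) by (auto simp: simplices_def J_def)
  qed
qed

lemma simplices_Suc_n: "simplices (n + 1) J = {cap}"
proof (intro equalityI subsetI)
  fix \<rho> assume "\<rho> \<in> simplices (n + 1) J"
  then have \<rho>: "\<rho> \<in> J" "card \<rho> = n + 2" by (auto simp: simplices_def)
  consider "\<rho> = cap" | v where "v \<in> cap" "\<rho> \<subseteq> cap - {v}" | F where "z F \<noteq> 0" "\<rho> \<subseteq> F"
    using card_J(1)[OF \<rho>(1)] by blast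
  then show "\<rho> \<in> {cap}"
  proof cases
    case 2
    then have "card \<rho> \<le> n + 1" using cap_props(2,3) card_mono[OF _ 2(2)] by simp
    then show ?thesis using \<rho>(2) by simp
  next
    case 3
    then have "card \<rho> \<le> n + 1" using z_supp[OF 3(1)] card_mono[OF _ 3(2)] by simp
    then show ?thesis using \<rho>(2) by simp
  qed simp
qed (auto simp: simplices_def J_def cap_props(2))

lemma complex_dim_J: "complex_dim J = int n + 1"
proof -
  have "finite J" using J_bound by (rule finite_subset) simp
  moreover have "cap \<in> J" by (auto simp: J_def)
  moreover have "int (card cap) - 1 = int n + 1" using cap_props(2) by simp
  ultimately have "(MAX \<sigma>\<in>J. int (card \<sigma>) - 1) = int n + 1"
    using card_J(2) by (intro Max_eqI) (force, force, metis image_eqI)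
  then show ?thesis using \<open>cap \<in> J\<close> by (auto simp: complex_dim_def)
qed

section \<open>Cycles of the capped complex modulo boundaries\<close>

lemma boundaries_J: "boundaries n J = range (\<lambda>r \<rho>. r * cap_bd \<rho>)"
proof -
  have c: "c \<in> carrier (chain_space (n + 1) J) \<longleftrightarrow> (\<exists>r. c = (\<lambda>\<rho>. r * single cap \<rho>))" for c
  proof
    assume "c \<in> carrier (chain_space (n + 1) J)"
    then have "c = (\<lambda>\<rho>. c cap * single cap \<rho>)"
      unfolding carrier_chain_space simplices_Suc_n by (auto simp: single_def fun_eq_iff)
    then show "\<exists>r. c = (\<lambda>\<rho>. r * single cap \<rho>)" by blast
  next
    assume "\<exists>r. c = (\<lambda>\<rho>. r * single cap \<rho>)"
    then show "c \<in> carrier (chain_space (n + 1) J)"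
      unfolding carrier_chain_space simplices_Suc_n by (elim exE) (simp add: single_def)
  qed
  have "boundaries n J = bd (Suc m) ` carrier (chain_space (n + 1) J)"
    unfolding boundaries_def by (intro image_cong refl boundary_eq_bd[OF J_bound]) simp_all
  also have "carrier (chain_space (n + 1) J) = range (\<lambda>r \<rho>. r * single cap \<rho>)"
    using c by blast
  finally show ?thesis by (simp add: image_image bd_smult cap_bd_def)
qed

lemma cap_bd_boundary: "(\<lambda>\<rho>. r * cap_bd \<rho>) \<in> boundaries n J"
  by (simp add: boundaries_J)

lemmas boundaries_cycles = subsetD[OF boundaries_subset_cycles[OF finite_complex_J n]]

lemma z_carrier: "z \<in> carrier (chain_space n J)"
  by (auto simp: carrier_chain_space simplices_n supp_def)

lemma z_cycle: "z \<in> cycles n J"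
proof -
  have "bd (Suc m) z \<rho> = 0" for \<rho>
  proof -
    have "z (insert m \<rho>) = 0" using z_supp(4)[of "insert m \<rho>"] by (cases "z (insert m \<rho>) = 0") auto
    then show ?thesis using circuit by (simp add: bd_Suc circuit_def)
  qed
  then show ?thesis using boundary_eq_bd[OF J_bound n z_carrier] z_carrier by (simp add: cycles_def fun_eq_iff)
qed

text \<open>The face \<open>cap - {v0, v}\<close> contains \<open>m\<close>, so the only
  \<open>n\<close>-simplices of \<open>J\<close> around it are the two facets
  \<open>cap - {v0}\<close> and \<open>cap - {v}\<close>. The cycle condition there carries
  vanishing from one to the other.\<close>

lemma cycle_vanishing_on_cap:
  assumes c: "c \<in> cycles n J" and v0: "v0 \<in> \<tau>" "c (cap - {v0}) = 0" and v: "v \<in> \<tau>"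
  shows "c (cap - {v}) = 0"
proof (cases "v = v0")
  case False
  let ?\<rho> = "cap - {v0, v}"
  have car: "c \<in> carrier (chain_space n J)" using c by (simp add: cycles_def)
  have m: "m \<noteq> v0" "m \<noteq> v" using v0 v \<tau>_props(4) by auto
  have 0: "c (insert u ?\<rho>) = 0" if "u \<notin> cap" for u
  proof -
    have "insert u ?\<rho> \<notin> simplices n J"
      using m cap_props(4) that z_supp(4)[of "insert u ?\<rho>"] by (auto simp: simplices_n supp_def)
    then show ?thesis using car by (simp add: carrier_chain_space)
  qed
  have "bd (Suc m) c ?\<rho> = (\<Sum>u\<in>{v0, v}. inc_sign ?\<rho> u * c (insert u ?\<rho>))"
    unfolding bd_def using 0 v0(1) v cap_props(1) by (intro sum.mono_neutral_right) (auto simp: cap_def)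
  also have "insert v0 ?\<rho> = cap - {v}" "insert v ?\<rho> = cap - {v0}"
    using v v0(1) False by (auto simp: cap_def)
  then have "(\<Sum>u\<in>{v0, v}. inc_sign ?\<rho> u * c (insert u ?\<rho>)) = inc_sign ?\<rho> v0 * c (cap - {v})"
    using False v0(2) by simp
  also have "bd (Suc m) c ?\<rho> = 0"
    using c boundary_eq_bd[OF J_bound n car] by (simp add: cycles_def)
  finally show ?thesis by simp
qed (use v0 in simp)

text \<open>Subtracting a multiple of \<open>cap_bd\<close> makes the cycle vanish on one facet of
  \<open>cap\<close> through \<open>m\<close>, hence on all of them. What remains is a cycle on the
  support of \<open>z\<close>, and the circuit property makes it a multiple of
  \<open>z\<close>.\<close>

lemma cycles_mod_boundaries:
  assumes c: "c \<in> cycles n J"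
  shows "\<exists>r. (\<lambda>\<rho>. c \<rho> - r * z \<rho>) \<in> boundaries n J"
proof -
  have "\<tau> \<noteq> {}" using \<tau>_props(2) by auto
  then obtain v0 where v0: "v0 \<in> \<tau>" by blast
  then have v0': "cap_bd (cap - {v0}) \<noteq> 0" using abs_cap_bd[of v0] by (auto simp: cap_def)
  \<comment> \<open>Chosen so that \<open>c'\<close> vanishes at \<open>cap - {v0}\<close>.\<close>
  define s where "s = c (cap - {v0}) / cap_bd (cap - {v0})"
  define c' where "c' = (\<lambda>\<rho>. c \<rho> - s * cap_bd \<rho>)"
  have c': "c' \<in> cycles n J"
    unfolding c'_def
    by (rule lin_closedD(4)[OF lin_closed_cycles c boundaries_cycles[OF cap_bd_boundary]])
  have "c' (cap - {v0}) = 0" using v0' by (simp add: c'_def s_def)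
  note c'0 = cycle_vanishing_on_cap[OF c' v0 this]
  have car: "c' \<in> carrier (chain_space n J)" using c' by (simp add: cycles_def)
  have sup: "z \<rho> \<noteq> 0" if "c' \<rho> \<noteq> 0" for \<rho>
  proof -
    have "\<rho> \<in> simplices n J" using car that by (auto simp: carrier_chain_space)
    then consider "z \<rho> \<noteq> 0" | "\<rho> = cap - {m}" | v where "v \<in> \<tau>" "\<rho> = cap - {v}"
      by (auto simp: simplices_n supp_def cap_def)
    then show ?thesis
    proof cases
      case 2
      then show ?thesis using cap_props(5) z_\<tau> by simp
    next
      case 3
      then show ?thesis using c'0 that by simp
    qed
  qed
  have "bd m c' \<rho> = 0" for \<rho>
  proof -
    \<comment> \<open>The circuit property is stated for vertices below \<open>m\<close>; since
      \<open>c'\<close> is zero on all sets containing \<open>m\<close>, passing from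
      \<open>Suc m\<close> to \<open>m\<close> does not change its boundary.\<close>
    have "c' (insert m \<rho>) = 0" using sup z_supp(4)[of "insert m \<rho>"] by blast
    then have "bd m c' \<rho> = bd (Suc m) c' \<rho>" by (simp add: bd_Suc)
    then show ?thesis using c' boundary_eq_bd[OF J_bound n car] by (simp add: cycles_def)
  qed
  then have "bd m c' = (\<lambda>\<rho>. 0)" by blast
  moreover have "supp c' \<subseteq> supp z" using sup by (auto simp: supp_def)
  ultimately obtain r where r: "c' = (\<lambda>\<rho>. r * z \<rho>)" using circuit unfolding circuit_def by blast
  have "c \<rho> - r * z \<rho> = s * cap_bd \<rho>" for \<rho> using fun_cong[OF r, of \<rho>] by (simp add: c'_def)
  then show ?thesis using cap_bd_boundary[of s] by (intro exI[of _ r]) simp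
qed

text \<open>The orthogonal projection of \<open>z\<close> away from \<open>cap_bd\<close>, which has squared norm \<open>n + 2\<close>.\<close>

definition h :: chain where
  "h = (\<lambda>\<rho>. z \<rho> - z \<tau> * cap_bd \<tau> / (real n + 2) * cap_bd \<rho>)"

lemma finite_simplices: "finite (simplices n J)"
proof (rule finite_subset)
  show "simplices n J \<subseteq> Pow {..<Suc m}" using J_bound by (auto simp: simplices_def)
qed simp

lemma \<tau>_simplex: "\<tau> \<in> simplices n J"
  using z_\<tau> by (simp add: simplices_n supp_def)

lemma inner_z_cap_bd: "chain_inner n J z cap_bd = z \<tau> * cap_bd \<tau>"
proof -
  have "z \<rho> * cap_bd \<rho> = 0" if "\<rho> \<noteq> \<tau>" for \<rho>
    using cap_bd_zero[OF _ that] z_supp(4)[of \<rho>] by (cases "z \<rho> = 0") auto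
  then have "chain_inner n J z cap_bd = (\<Sum>\<rho>\<in>{\<tau>}. z \<rho> * cap_bd \<rho>)"
    unfolding chain_inner_def using finite_simplices \<tau>_simplex
    by (intro sum.mono_neutral_right) auto
  then show ?thesis by simp
qed

lemma inner_cap_bd: "chain_inner n J cap_bd cap_bd = real n + 2"
proof -
  have inj: "inj_on (\<lambda>v. cap - {v}) cap" by (auto simp: inj_on_def)
  have "chain_inner n J cap_bd cap_bd = (\<Sum>\<rho>\<in>(\<lambda>v. cap - {v}) ` cap. cap_bd \<rho> * cap_bd \<rho>)"
    unfolding chain_inner_def using finite_simplices cap_bd_nonzero
    by (intro sum.mono_neutral_right) (auto simp: simplices_n)
  also have "\<dots> = (\<Sum>\<rho>\<in>(\<lambda>v. cap - {v}) ` cap. 1)"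
  proof (intro sum.cong refl)
    fix \<rho> assume "\<rho> \<in> (\<lambda>v. cap - {v}) ` cap"
    then have "\<bar>cap_bd \<rho>\<bar> = 1" using abs_cap_bd by blast
    then show "cap_bd \<rho> * cap_bd \<rho> = 1" by (metis abs_mult_self_eq mult_1)
  qed
  also have "\<dots> = real n + 2" using card_image[OF inj] cap_props(2) by simp
  finally show ?thesis .
qed

lemma h_harmonic: "h \<in> harmonic n J"
proof -
  have cyc: "h \<in> cycles n J"
    unfolding h_def
    by (rule lin_closedD(4)[OF lin_closed_cycles z_cycle boundaries_cycles[OF cap_bd_boundary]])
  have "chain_inner n J h cap_bd = 0"
    using chain_inner_add_smult[of n J z "- (z \<tau> * cap_bd \<tau> / (real n + 2))" cap_bd cap_bd]
    by (simp add: h_def inner_z_cap_bd inner_cap_bd)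
  moreover have "chain_inner n J h (\<lambda>\<rho>. r * cap_bd \<rho>) = r * chain_inner n J h cap_bd" for r
    by (simp add: chain_inner_def sum_distrib_left algebra_simps)
  ultimately have "h \<in> orth n J (boundaries n J)"
    using cyc by (auto simp: orth_def boundaries_J cycles_def)
  then show ?thesis using cyc by (simp add: harmonic_def)
qed

lemma h_\<tau>: "h \<tau> = z \<tau> * ((real n + 1) / (real n + 2))"
proof -
  have "cap_bd \<tau> * cap_bd \<tau> = 1" using abs_cap_bd_\<tau> by (metis abs_mult_self_eq mult_1)
  then have "h \<tau> = z \<tau> - z \<tau> / (real n + 2)" by (simp add: h_def)
  also have "\<dots> = z \<tau> * ((real n + 1) / (real n + 2))" by (simp add: field_simps)
  finally show ?thesis .
qed

lemma chain_inner_single: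
  assumes "\<rho> \<in> simplices n J"
  shows "chain_inner n J c (single \<rho>) = c \<rho>"
proof -
  have "chain_inner n J c (single \<rho>) = (\<Sum>\<sigma>\<in>simplices n J. if \<sigma> = \<rho> then c \<sigma> else 0)"
    unfolding chain_inner_def by (intro sum.cong) (auto simp: single_def)
  then show ?thesis using finite_simplices assms by simp
qed

context
  fixes \<sigma> assumes z_\<sigma>: "z \<sigma> \<noteq> 0" and ne: "\<sigma> \<noteq> \<tau>"
begin

lemma cap_bd_\<sigma>: "cap_bd \<sigma> = 0"
  using cap_bd_zero z_supp(4)[OF z_\<sigma>] ne by blast

lemma h_\<sigma>: "h \<sigma> = z \<sigma>"
  by (simp add: h_def cap_bd_\<sigma>)

lemma boundary_vanishes: "b \<in> boundaries n J \<Longrightarrow> b \<sigma> = 0"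
  by (auto simp: boundaries_J cap_bd_\<sigma>)

lemma z_not_boundary: "z \<notin> boundaries n J"
  using boundary_vanishes z_\<sigma> by blast

lemmas homology_J = rank_one_homology[OF finite_complex_J n z_cycle z_not_boundary cycles_mod_boundaries]

lemma \<sigma>_essential: "\<sigma> \<in> essential n [{}, J] (1, \<infinity>, 1)"
proof -
  have "y \<sigma> \<noteq> 0" if y: "y \<in> cycles n J" "y \<notin> boundaries n J" for y
  proof -
    obtain r where r: "(\<lambda>\<rho>. y \<rho> - r * z \<rho>) \<in> boundaries n J" using cycles_mod_boundaries y(1) by blast
    then have "r \<noteq> 0" using y(2) by auto
    then show ?thesis using boundary_vanishes[OF r] z_\<sigma> by simp
  qed
  then show ?thesis unfolding essential_def Rep_two_step supp_def by blast
qed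

lemma \<tau>_not_essential: "\<tau> \<notin> essential n [{}, J] (1, \<infinity>, 1)"
proof -
  define b where "b = (\<lambda>\<rho>. z \<tau> / cap_bd \<tau> * cap_bd \<rho>)"
  have b: "b \<in> boundaries n J" unfolding b_def by (rule cap_bd_boundary)
  define y where "y = (\<lambda>\<rho>. z \<rho> - b \<rho>)"
  have "y \<in> cycles n J"
    unfolding y_def by (rule lin_closedD(4)[OF lin_closed_cycles z_cycle boundaries_cycles[OF b]])
  moreover have "y \<notin> boundaries n J"
    using z_not_boundary lin_closedD(3)[OF lin_closed_boundaries _ b, of y] by (auto simp: y_def)
  moreover have "y \<tau> = 0" using abs_cap_bd_\<tau> by (auto simp: y_def b_def)
  ultimately show ?thesis unfolding essential_def Rep_two_step supp_def by blast
qed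

end

end

theorem theorem4:
  fixes n :: nat
  assumes "n \<ge> 3"
  shows "\<exists>J. finite_complex J \<and> complex_dim J = int n + 1 \<and>
    real_dim (homology n J) = 1 \<and>
    is_filtration [{}, J] \<and>
    (\<exists>b h \<sigma> \<tau>. b = (1, \<infinity>, 1) \<and> b \<in> barcode n [{}, J] \<and> generic_bar n [{}, J] b \<and>
      harmonic_representative n [{}, J] b h \<and>
      \<sigma> \<in> essential n [{}, J] b \<and>
      \<tau> \<in> simplices n J - essential n [{}, J] b \<and>
      \<bar>chain_inner n J h (single \<sigma>)\<bar> < \<bar>chain_inner n J h (single \<tau>)\<bar>)"
proof -
  have "n \<ge> 2" using assms by simp
  then obtain m z \<sigma> \<tau> where z: "circuit n m z" "\<bar>z \<sigma>\<bar> = 1" "\<bar>z \<tau>\<bar> = 2"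
    using ex_circuit by blast
  interpret capped_circuit n m z \<tau> using z assms by unfold_locales auto
  have \<sigma>: "z \<sigma> \<noteq> 0" "\<sigma> \<noteq> \<tau>" using z by auto
  note bar = generic_bar_two_step[OF homology_J(2)[OF \<sigma>]]
  have "h \<noteq> (\<lambda>\<sigma>. 0)" using h_\<sigma>[OF \<sigma>] \<sigma>(1) by metis
  then have rep: "harmonic_representative n [{}, J] (1, \<infinity>, 1) h"
    using bar(3) h_harmonic harm_P_two_step[OF finite_complex_J]
    by (simp add: harmonic_representative_def del: One_nat_def)
  have "\<bar>h \<sigma>\<bar> = 1" using h_\<sigma>[OF \<sigma>] z(2) by simp
  moreover have "\<bar>h \<tau>\<bar> = 2 * ((real n + 1) / (real n + 2))"
    using z(3) by (simp add: h_\<tau> abs_mult)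
  moreover have "1 < 2 * ((real n + 1) / (real n + 2))" using assms by (simp add: field_simps)
  moreover have "\<sigma> \<in> simplices n J" using \<sigma>(1) by (simp add: simplices_n supp_def)
  ultimately have less: "\<bar>chain_inner n J h (single \<sigma>)\<bar> < \<bar>chain_inner n J h (single \<tau>)\<bar>"
    using \<tau>_simplex by (simp add: chain_inner_single)
  have "is_filtration [{}, J]"
    using finite_complex_J by (simp add: is_filtration_def finite_complex_def nth_Cons split: nat.splits)
  then show ?thesis
    using finite_complex_J complex_dim_J homology_J(1)[OF \<sigma>] bar(1,2) rep \<sigma>_essential[OF \<sigma>]
      \<tau>_simplex \<tau>_not_essential[OF \<sigma>] less by blast
qed

end
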